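(* Let $X$ be a compact complex manifold of complex dimension $n$. For all $p,q$ there are decompositions (isomorphisms of complex vector spaces, depending on a choice of hermitian metric) $$H^{p,q}_{BC}\cong\partial G^{p-1,q}_{\partial}\oplus\partial L^{p-1,q}_{\partial}\oplus\bar\partial L^{p,q-1}_{\bar\partial}\oplus K^{p,q},$$ $$H^{p,q}_{BC}\cong\bar\partial G^{p,q-1}_{\bar\partial}\oplus\bar\partial L^{p,q-1}_{\bar\partial}\oplus\partial L^{p-1,q}_{\partial}\oplus K^{p,q},$$ $$H^{p,q}_A\cong H^{p,q}_{\partial}/(\bar\partial L^{p,q-1}_{\bar\partial})\oplus G^{p,q}_{\partial}\oplus L^{p,q}_{\partial},$$ $$H^{p,q}_A\cong H^{p,q}_{\bar\partial}/(\partial L^{p-1,q}_{\partial})\oplus G^{p,q}_{\bar\partial}\oplus L^{p,q}_{\bar\partial}.$$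
   Context: On smooth complex-valued $(p,q)$-forms on $X$, define $$H^{p,q}_{BC}=\frac{\ker(\partial)\cap\ker(\bar\partial)}{\operatorname{im}(\partial\bar\partial)},\quad H^{p,q}_A=\frac{\ker(\partial\bar\partial)}{\operatorname{im}(\partial)+\operatorname{im}(\bar\partial)},\quad K^{p,q}=\frac{\ker(\partial)\cap\ker(\bar\partial)}{\operatorname{im}(\partial)\cap\ker(\bar\partial)+\operatorname{im}(\bar\partial)\cap\ker(\partial)},$$ $H^{p,q}_{\bar\partial}=\ker(\bar\partial)/\operatorname{im}(\bar\partial)$, $H^{p,q}_{\partial}=\ker(\partial)/\operatorname{im}(\partial)$ (all spaces in bidegree $(p,q)$, zero outside the range $0\le p,q\le n$). Consider the maps $\partial:H^{p,q}_A\to H^{p+1,q}_{\bar\partial}$, $[\theta]_A\mapsto[\partial\theta]_{\bar\partial}$, and $\bar\partial:H^{p,q}_A\to H^{p,q+1}_{\partial}$, $[\theta]_A\mapsto[\bar\partial\theta]_{\partial}$, and the natural maps $\pi_A$ from $H^{p,q}_{\partial}$ and $H^{p,q}_{\bar\partial}$ to $H^{p,q}_A$ induced by the identity on forms. Set $$\mathcal G^{p,q}_{\partial}=\ker(\partial:H^{p,q}_A\to H^{p+1,q}_{\bar\partial}),\quad G^{p,q}_{\partial}=\mathcal G^{p,q}_{\partial}/\operatorname{im}(\pi_A:H^{p,q}_{\partial}\to H^{p,q}_A),\quad L^{p,q}_{\partial}=H^{p,q}_A/\mathcal G^{p,q}_{\partial},$$ $$\mathcal G^{p,q}_{\bar\partial}=\ker(\bar\partial:H^{p,q}_A\to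 H^{p,q+1}_{\partial}),\quad G^{p,q}_{\bar\partial}=\mathcal G^{p,q}_{\bar\partial}/\operatorname{im}(\pi_A:H^{p,q}_{\bar\partial}\to H^{p,q}_A),\quad L^{p,q}_{\bar\partial}=H^{p,q}_A/\mathcal G^{p,q}_{\bar\partial}.$$ Using orthogonal complements for a hermitian metric, $G$ and $L$ (with either subscript) are regarded as subspaces of $H_A$. In the decompositions of $H^{p,q}_{BC}$, $\partial G$, $\partial L$ (resp. $\bar\partial G$, $\bar\partial L$) denote the images of these subspaces under $\partial:H^{p-1,q}_A\to H^{p,q}_{BC}$, $[\theta]_A\mapsto[\partial\theta]_{BC}$ (resp. $\bar\partial:H^{p,q-1}_A\to H^{p,q}_{BC}$, $[\theta]_A\mapsto[\bar\partial\theta]_{BC}$). In the decompositions of $H^{p,q}_A$, $\bar\partial L^{p,q-1}_{\bar\partial}$ denotes the (injective) image of $L^{p,q-1}_{\bar\partial}$ in $H^{p,q}_{\partial}$ under $\bar\partial$, and $\partial L^{p-1,q}_{\partial}$ the (injective) image of $L^{p-1,q}_{\partial}$ in $H^{p,q}_{\bar\partial}$ under $\partial$. *)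

theory Defs
  imports "HOL-Analysis.Analysis" "HOL-Library.Function_Algebras"
begin

section \<open>Complex vector spaces with explicit carrier\<close>

record 'v cvs =
  carr :: "'v set"
  vadd :: "'v \<Rightarrow> 'v \<Rightarrow> 'v"
  vzero :: "'v"
  vscale :: "complex \<Rightarrow> 'v \<Rightarrow> 'v"

definition vsubspace :: "('v, 'm) cvs_scheme \<Rightarrow> 'v set \<Rightarrow> bool" where
  "vsubspace V W \<longleftrightarrow> W \<subseteq> carr V \<and> vzero V \<in> W \<and>
     (\<forall>x\<in>W. \<forall>y\<in>W. vadd V x y \<in> W) \<and> (\<forall>a. \<forall>x\<in>W. vscale V a x \<in> W)"

definition vrestrict :: "'v cvs \<Rightarrow> 'v set \<Rightarrow> 'v cvs" where
  "vrestrict V W = V\<lparr>carr := W\<rparr>"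

definition vcoset :: "'v cvs \<Rightarrow> 'v set \<Rightarrow> 'v \<Rightarrow> 'v set" where
  "vcoset V W x = {vadd V x w |w. w \<in> W}"

text \<open>The quotient of \<open>V\<close> by a subspace \<open>W\<close>, with cosets as elements. In the scalar
  multiplication \<open>W\<close> is added so that also \<open>0\<close> times a coset is a coset.\<close>

definition vquot :: "'v cvs \<Rightarrow> 'v set \<Rightarrow> 'v set cvs" where
  "vquot V W = \<lparr>
     carr = vcoset V W ` carr V,
     vadd = (\<lambda>C D. {vadd V x y |x y. x \<in> C \<and> y \<in> D}),
     vzero = W,
     vscale = (\<lambda>a C. {vadd V (vscale V a x) w |x w. x \<in> C \<and> w \<in> W})\<rparr>"

definition vdsum :: "'v cvs \<Rightarrow> 'w cvs \<Rightarrow> ('v \<times> 'w) cvs" (infixr "\<oplus>\<^sub>v" 65) where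
  "V \<oplus>\<^sub>v W = \<lparr>
     carr = carr V \<times> carr W,
     vadd = (\<lambda>(x, y) (x', y'). (vadd V x x', vadd W y y')),
     vzero = (vzero V, vzero W),
     vscale = (\<lambda>a (x, y). (vscale V a x, vscale W a y))\<rparr>"

definition viso :: "'v cvs \<Rightarrow> 'w cvs \<Rightarrow> bool" (infix "\<cong>\<^sub>v" 50) where
  "V \<cong>\<^sub>v W \<longleftrightarrow> (\<exists>f. bij_betw f (carr V) (carr W) \<and>
     (\<forall>x\<in>carr V. \<forall>y\<in>carr V. f (vadd V x y) = vadd W (f x) (f y)) \<and>
     (\<forall>a. \<forall>x\<in>carr V. f (vscale V a x) = vscale W a (f x)))"

definition complement_of :: "'v cvs \<Rightarrow> 'v set \<Rightarrow> 'v set \<Rightarrow> bool" where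
  "complement_of V U W \<longleftrightarrow> vsubspace V W \<and> U \<inter> W = {vzero V} \<and>
     {vadd V u w |u w. u \<in> U \<and> w \<in> W} = carr V"


section \<open>Smooth and holomorphic maps\<close>

text \<open>Only used for open \<open>S\<close>.\<close>

primrec Ck_on :: "nat \<Rightarrow> 'a::euclidean_space set \<Rightarrow> ('a \<Rightarrow> 'b::real_normed_vector) \<Rightarrow> bool" where
  "Ck_on 0 S f \<longleftrightarrow> continuous_on S f"
| "Ck_on (Suc k) S f \<longleftrightarrow> (\<forall>x\<in>S. f differentiable at x) \<and>
     (\<forall>v. Ck_on k S (\<lambda>x. frechet_derivative f (at x) v))"

definition smooth_on :: "'a::euclidean_space set \<Rightarrow> ('a \<Rightarrow> 'b::real_normed_vector) \<Rightarrow> bool" where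
  "smooth_on S f \<longleftrightarrow> (\<forall>k. Ck_on k S f)"

text \<open>Holomorphic in several variables: smooth, with complex linear derivative
  (that is, satisfying the Cauchy-Riemann equations).\<close>

definition holomorphic_map_on :: "(complex^'n::finite) set \<Rightarrow> (complex^'n \<Rightarrow> complex^'n) \<Rightarrow> bool" where
  "holomorphic_map_on S f \<longleftrightarrow> smooth_on S f \<and>
     (\<forall>x\<in>S. \<forall>a v. frechet_derivative f (at x) (a *s v) = a *s frechet_derivative f (at x) v)"


section \<open>Compact complex manifolds\<close>

text \<open>A chart is a domain with a coordinate map; only the values of the map on the domain matter.
  The complex dimension is \<open>CARD('n)\<close>.\<close>

type_synonym ('a, 'n) chart = "'a set \<times> ('a \<Rightarrow> complex^'n)"

definition chart_image :: "('a, 'n::finite) chart \<Rightarrow> (complex^'n) set" where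
  "chart_image c = snd c ` fst c"

definition overlap :: "('a, 'n::finite) chart \<Rightarrow> ('a, 'n) chart \<Rightarrow> (complex^'n) set" where
  "overlap c d = snd c ` (fst c \<inter> fst d)"

definition transition :: "('a, 'n::finite) chart \<Rightarrow> ('a, 'n) chart \<Rightarrow> complex^'n \<Rightarrow> complex^'n" where
  "transition c d = snd d \<circ> inv_into (fst c) (snd c)"

definition complex_chart :: "'a topology \<Rightarrow> ('a, 'n::finite) chart \<Rightarrow> bool" where
  "complex_chart X c \<longleftrightarrow> openin X (fst c) \<and> open (chart_image c) \<and>
     homeomorphic_map (subtopology X (fst c)) (top_of_set (chart_image c)) (snd c)"

definition complex_atlas :: "'a topology \<Rightarrow> ('a, 'n::finite) chart set \<Rightarrow> bool" where
  "complex_atlas X A \<longleftrightarrow> (\<forall>c\<in>A. complex_chart X c) \<and> (\<Union>c\<in>A. fst c) = topspace X \<and>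
     (\<forall>c\<in>A. \<forall>d\<in>A. holomorphic_map_on (overlap c d) (transition c d))"

definition compact_complex_manifold :: "'a topology \<Rightarrow> ('a, 'n::finite) chart set \<Rightarrow> bool" where
  "compact_complex_manifold X A \<longleftrightarrow> compact_space X \<and> Hausdorff_space X \<and> complex_atlas X A"


section \<open>Differential forms\<close>

text \<open>An alternating \<open>k\<close>-form on \<open>\<complex>\<^sup>n\<close> (as a real vector space) is represented as a function on
  lists of vectors, vanishing on lists of length different from \<open>k\<close>. The exterior product with a
  \<open>1\<close>-form on the left is
  \<open>(\<alpha> \<and> \<eta>)(v\<^sub>0, \<dots>, v\<^sub>k) = \<Sum>\<^sub>i (-1)\<^sup>i \<alpha>(v\<^sub>i) \<eta>(v\<^sub>0, \<dots>, v\<^sub>i omitted, \<dots>, v\<^sub>k)\<close>.\<close>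

definition wedge1 ::
  "(complex^'n::finite \<Rightarrow> complex) \<Rightarrow> ((complex^'n) list \<Rightarrow> complex) \<Rightarrow> (complex^'n) list \<Rightarrow> complex" where
  "wedge1 \<alpha> \<eta> vs = (\<Sum>i<length vs. (-1) ^ i * \<alpha> (vs ! i) * \<eta> (take i vs @ drop (Suc i) vs))"

definition unit_form :: "(complex^'n::finite) list \<Rightarrow> complex" where
  "unit_form vs = (if vs = [] then 1 else 0)"

definition dz :: "'n::finite \<Rightarrow> complex^'n \<Rightarrow> complex" where
  "dz j v = v $ j"

definition dzbar :: "'n::finite \<Rightarrow> complex^'n \<Rightarrow> complex" where
  "dzbar j v = cnj (v $ j)"

definition dz_dzbar :: "'n::finite list \<Rightarrow> 'n list \<Rightarrow> (complex^'n) list \<Rightarrow> complex" where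
  "dz_dzbar I J = foldr wedge1 (map dz I @ map dzbar J) unit_form"

text \<open>Smooth \<open>(p,q)\<close>-forms \<open>\<Sum> f\<^sub>I\<^sub>J dz\<^sub>I \<and> dzbar\<^sub>J\<close> on an open set. The sum is over all multi-indices,
  not only the increasing ones, so the coefficients are not unique.\<close>

definition local_form ::
  "nat \<Rightarrow> nat \<Rightarrow> (complex^'n::finite) set \<Rightarrow> (complex^'n \<Rightarrow> (complex^'n) list \<Rightarrow> complex) \<Rightarrow> bool" where
  "local_form p q U \<omega> \<longleftrightarrow> (\<exists>f. (\<forall>I J. smooth_on U (f I J)) \<and>
     (\<forall>z\<in>U. \<forall>vs. \<omega> z vs =
        (\<Sum>I\<in>{I. length I = p}. \<Sum>J\<in>{J. length J = q}. f I J z * dz_dzbar I J vs)))"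

text \<open>A form on the manifold is the family of its local expressions in the charts of the atlas,
  related by pullback along the transition maps; it is extended by zero outside the chart images.
  The bidegree is an integer so that \<open>p - 1\<close> makes sense for \<open>p = 0\<close>; for \<open>p\<close> or \<open>q\<close> greater
  than the dimension all \<open>dz_dzbar I J\<close> vanish.\<close>

type_synonym ('a, 'n) form = "('a, 'n) chart \<Rightarrow> complex^'n \<Rightarrow> (complex^'n) list \<Rightarrow> complex"

definition forms :: "('a, 'n::finite) chart set \<Rightarrow> int \<Rightarrow> int \<Rightarrow> ('a, 'n) form set" where
  "forms A p q = (if 0 \<le> p \<and> 0 \<le> q then
     {\<omega>. (\<forall>c\<in>A. local_form (nat p) (nat q) (chart_image c) (\<omega> c)) \<and>
         (\<forall>c\<in>A. \<forall>d\<in>A. \<forall>z\<in>overlap c d. \<forall>vs. \<omega> c z vs =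
            \<omega> d (transition c d z) (map (frechet_derivative (transition c d) (at z)) vs)) \<and>
         (\<forall>c z. c \<notin> A \<or> z \<notin> chart_image c \<longrightarrow> \<omega> c z = 0)}
     else {0})"

definition form_space :: "('a, 'n::finite) chart set \<Rightarrow> int \<Rightarrow> int \<Rightarrow> ('a, 'n) form cvs" where
  "form_space A p q = \<lparr>carr = forms A p q, vadd = (+), vzero = 0,
     vscale = (\<lambda>a \<omega> c z vs. a * \<omega> c z vs)\<rparr>"

definition wirtinger :: "'n::finite \<Rightarrow> (complex^'n \<Rightarrow> complex) \<Rightarrow> complex^'n \<Rightarrow> complex" where
  "wirtinger j f z = (frechet_derivative f (at z) (axis j 1)
     - \<i> * frechet_derivative f (at z) (axis j \<i>)) / 2"

definition wirtinger_bar :: "'n::finite \<Rightarrow> (complex^'n \<Rightarrow> complex) \<Rightarrow> complex^'n \<Rightarrow> complex" where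
  "wirtinger_bar j f z = (frechet_derivative f (at z) (axis j 1)
     + \<i> * frechet_derivative f (at z) (axis j \<i>)) / 2"

text \<open>In a chart, \<open>\<partial>\<omega> = \<Sum>\<^sub>j dz\<^sub>j \<and> \<partial>\<omega>/\<partial>z\<^sub>j\<close>, and similarly for \<open>delbar\<close>.\<close>

definition del :: "('a, 'n::finite) chart set \<Rightarrow> ('a, 'n) form \<Rightarrow> ('a, 'n) form" where
  "del A \<omega> = (\<lambda>c z vs. if c \<in> A \<and> z \<in> chart_image c
     then \<Sum>j\<in>UNIV. wedge1 (dz j) (\<lambda>ws. wirtinger j (\<lambda>x. \<omega> c x ws) z) vs else 0)"

definition delbar :: "('a, 'n::finite) chart set \<Rightarrow> ('a, 'n) form \<Rightarrow> ('a, 'n) form" where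
  "delbar A \<omega> = (\<lambda>c z vs. if c \<in> A \<and> z \<in> chart_image c
     then \<Sum>j\<in>UNIV. wedge1 (dzbar j) (\<lambda>ws. wirtinger_bar j (\<lambda>x. \<omega> c x ws) z) vs else 0)"


section \<open>Cohomology\<close>

text \<open>Kernels and images in bidegree \<open>(p,q)\<close>.\<close>

definition ker_del :: "('a, 'n::finite) chart set \<Rightarrow> int \<Rightarrow> int \<Rightarrow> ('a, 'n) form set" where
  "ker_del A p q = {\<omega> \<in> forms A p q. del A \<omega> = 0}"

definition ker_delbar :: "('a, 'n::finite) chart set \<Rightarrow> int \<Rightarrow> int \<Rightarrow> ('a, 'n) form set" where
  "ker_delbar A p q = {\<omega> \<in> forms A p q. delbar A \<omega> = 0}"

definition ker_deldelbar :: "('a, 'n::finite) chart set \<Rightarrow> int \<Rightarrow> int \<Rightarrow> ('a, 'n) form set" where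
  "ker_deldelbar A p q = {\<omega> \<in> forms A p q. del A (delbar A \<omega>) = 0}"

definition im_del :: "('a, 'n::finite) chart set \<Rightarrow> int \<Rightarrow> int \<Rightarrow> ('a, 'n) form set" where
  "im_del A p q = del A ` forms A (p - 1) q"

definition im_delbar :: "('a, 'n::finite) chart set \<Rightarrow> int \<Rightarrow> int \<Rightarrow> ('a, 'n) form set" where
  "im_delbar A p q = delbar A ` forms A p (q - 1)"

definition im_deldelbar :: "('a, 'n::finite) chart set \<Rightarrow> int \<Rightarrow> int \<Rightarrow> ('a, 'n) form set" where
  "im_deldelbar A p q = (\<lambda>\<omega>. del A (delbar A \<omega>)) ` forms A (p - 1) (q - 1)"

definition sum_of :: "('a, 'n::finite) form set \<Rightarrow> ('a, 'n) form set \<Rightarrow> ('a, 'n) form set" where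
  "sum_of S T = {\<alpha> + \<beta> |\<alpha> \<beta>. \<alpha> \<in> S \<and> \<beta> \<in> T}"

definition H_BC :: "('a, 'n::finite) chart set \<Rightarrow> int \<Rightarrow> int \<Rightarrow> ('a, 'n) form set cvs" where
  "H_BC A p q = vquot (vrestrict (form_space A p q) (ker_del A p q \<inter> ker_delbar A p q))
     (im_deldelbar A p q)"

definition H_A :: "('a, 'n::finite) chart set \<Rightarrow> int \<Rightarrow> int \<Rightarrow> ('a, 'n) form set cvs" where
  "H_A A p q = vquot (vrestrict (form_space A p q) (ker_deldelbar A p q))
     (sum_of (im_del A p q) (im_delbar A p q))"

definition K :: "('a, 'n::finite) chart set \<Rightarrow> int \<Rightarrow> int \<Rightarrow> ('a, 'n) form set cvs" where
  "K A p q = vquot (vrestrict (form_space A p q) (ker_del A p q \<inter> ker_delbar A p q))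
     (sum_of (im_del A p q \<inter> ker_delbar A p q) (im_delbar A p q \<inter> ker_del A p q))"

definition H_del :: "('a, 'n::finite) chart set \<Rightarrow> int \<Rightarrow> int \<Rightarrow> ('a, 'n) form set cvs" where
  "H_del A p q = vquot (vrestrict (form_space A p q) (ker_del A p q)) (im_del A p q)"

definition H_delbar :: "('a, 'n::finite) chart set \<Rightarrow> int \<Rightarrow> int \<Rightarrow> ('a, 'n) form set cvs" where
  "H_delbar A p q = vquot (vrestrict (form_space A p q) (ker_delbar A p q)) (im_delbar A p q)"

text \<open>The map of quotients induced by a map \<open>f\<close> of forms, where \<open>B\<close> is the subspace divided out in
  the target: it sends the class of \<open>\<theta>\<close> to the coset \<open>f \<theta> + B\<close>.\<close>

definition induced ::
  "(('a, 'n::finite) form \<Rightarrow> ('a, 'n) form) \<Rightarrow> ('a, 'n) form set \<Rightarrow> ('a, 'n) form set \<Rightarrow> ('a, 'n) form set" where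
  "induced f B C = {f \<theta> + \<beta> |\<theta> \<beta>. \<theta> \<in> C \<and> \<beta> \<in> B}"

text \<open>In the following maps \<open>(p,q)\<close> is the bidegree of the source.\<close>

definition del_A_BC :: "('a, 'n::finite) chart set \<Rightarrow> int \<Rightarrow> int \<Rightarrow> ('a, 'n) form set \<Rightarrow> ('a, 'n) form set" where
  "del_A_BC A p q = induced (del A) (im_deldelbar A (p + 1) q)"

definition delbar_A_BC :: "('a, 'n::finite) chart set \<Rightarrow> int \<Rightarrow> int \<Rightarrow> ('a, 'n) form set \<Rightarrow> ('a, 'n) form set" where
  "delbar_A_BC A p q = induced (delbar A) (im_deldelbar A p (q + 1))"

definition del_A_delbar :: "('a, 'n::finite) chart set \<Rightarrow> int \<Rightarrow> int \<Rightarrow> ('a, 'n) form set \<Rightarrow> ('a, 'n) form set" where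
  "del_A_delbar A p q = induced (del A) (im_delbar A (p + 1) q)"

definition delbar_A_del :: "('a, 'n::finite) chart set \<Rightarrow> int \<Rightarrow> int \<Rightarrow> ('a, 'n) form set \<Rightarrow> ('a, 'n) form set" where
  "delbar_A_del A p q = induced (delbar A) (im_del A p (q + 1))"

definition pi_A :: "('a, 'n::finite) chart set \<Rightarrow> int \<Rightarrow> int \<Rightarrow> ('a, 'n) form set \<Rightarrow> ('a, 'n) form set" where
  "pi_A A p q = induced id (sum_of (im_del A p q) (im_delbar A p q))"

definition cG_del :: "('a, 'n::finite) chart set \<Rightarrow> int \<Rightarrow> int \<Rightarrow> ('a, 'n) form set set" where
  "cG_del A p q = {h \<in> carr (H_A A p q). del_A_delbar A p q h = vzero (H_delbar A (p + 1) q)}"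

definition cG_delbar :: "('a, 'n::finite) chart set \<Rightarrow> int \<Rightarrow> int \<Rightarrow> ('a, 'n) form set set" where
  "cG_delbar A p q = {h \<in> carr (H_A A p q). delbar_A_del A p q h = vzero (H_del A p (q + 1))}"

text \<open>The quotients \<open>G\<close> (of \<open>cG\<close> by the image of \<open>pi_A\<close>) and \<open>L\<close> (of \<open>H_A\<close> by \<open>cG\<close>) are regarded
  as subspaces of \<open>H_A\<close> by choosing a complement of the subspace divided out. A hermitian metric
  provides such a choice, namely the orthogonal complements in the finite-dimensional space \<open>H_A\<close>;
  the predicates below allow any choice.\<close>

definition is_G_del :: "('a, 'n::finite) chart set \<Rightarrow> int \<Rightarrow> int \<Rightarrow> ('a, 'n) form set set \<Rightarrow> bool" where
  "is_G_del A p q G \<longleftrightarrow> complement_of (vrestrict (H_A A p q) (cG_del A p q))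
     (pi_A A p q ` carr (H_del A p q)) G"

definition is_L_del :: "('a, 'n::finite) chart set \<Rightarrow> int \<Rightarrow> int \<Rightarrow> ('a, 'n) form set set \<Rightarrow> bool" where
  "is_L_del A p q L \<longleftrightarrow> complement_of (H_A A p q) (cG_del A p q) L"

definition is_G_delbar :: "('a, 'n::finite) chart set \<Rightarrow> int \<Rightarrow> int \<Rightarrow> ('a, 'n) form set set \<Rightarrow> bool" where
  "is_G_delbar A p q G \<longleftrightarrow> complement_of (vrestrict (H_A A p q) (cG_delbar A p q))
     (pi_A A p q ` carr (H_delbar A p q)) G"

definition is_L_delbar :: "('a, 'n::finite) chart set \<Rightarrow> int \<Rightarrow> int \<Rightarrow> ('a, 'n) form set set \<Rightarrow> bool" where
  "is_L_delbar A p q L \<longleftrightarrow> complement_of (H_A A p q) (cG_delbar A p q) L"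

end

(* The forms with del and delbar make up a double complex; the point is that del and delbar do not depend on the chart. Writing a form as a sum of
   f dz_I dzbar_J, this comes down to the pullbacks of dz_j and dzbar_j along a holomorphic map being
   closed, that is, to the symmetry of second derivatives.

   The rest is linear algebra. In H_BC the kernel of the projection to K is the sum of the images of
   del and delbar from H_A. The first map has kernel im pi_A, so its image is del G + del L; and
   delbar theta lies in the image of del exactly when theta is in the kernel of
   delbar : H_A -> H_del, so only delbar Lb is new. For H_A, the filtration im pi_A <= cG <= H_A has
   graded pieces im pi_A, G, L, and the kernel of pi_A on H_del is the image of delbar from H_A,
   which is that of Lb. Exchanging the roles of del and delbar gives the other two decompositions. *)

theory Submission
  imports Defs
begin

section \<open>Symmetry of second derivatives\<close>

lemma second_difference_tendsto:
  fixes f :: "'a::real_normed_vector \<Rightarrow> real"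
  assumes S: "open S" "z \<in> S"
    and F: "\<And>x. x \<in> S \<Longrightarrow> (f has_derivative F x) (at x)"
    and L: "((\<lambda>x. F x u) has_derivative L) (at z)"
  shows "((\<lambda>t. (f (z + t *\<^sub>R u + t *\<^sub>R v) - f (z + t *\<^sub>R u) - f (z + t *\<^sub>R v) + f z) / t\<^sup>2) \<longlongrightarrow> L v) (at_right 0)"
proof (rule tendstoI)
  fix e :: real assume e: "e > 0"
  define c where "c = e / (2 * norm u + norm v + 1)"
  have c: "c > 0" using e by (simp add: c_def add_nonneg_pos)
  have Lin: "linear L" using L has_derivative_linear by blast
  obtain d where d: "d > 0" and
    dL: "\<And>y. norm (y - z) < d \<Longrightarrow> norm (F y u - F z u - L (y - z)) \<le> c * norm (y - z)"
    using L c unfolding has_derivative_at_alt by blast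
  obtain r where r: "r > 0" "ball z r \<subseteq> S" using S open_contains_ball by blast
  define b where "b = min d r / (norm u + norm v + 1)"
  have b: "b > 0" using d r by (simp add: b_def add_nonneg_pos)
  have "dist ((f (z + t *\<^sub>R u + t *\<^sub>R v) - f (z + t *\<^sub>R u) - f (z + t *\<^sub>R v) + f z) / t\<^sup>2) (L v) < e"
    if t: "0 < t" "t < b" for t
  proof -
    have "t * (norm u + norm v + 1) < min d r"
      using t(2) unfolding b_def by (subst (asm) pos_less_divide_eq) (auto simp: add_nonneg_pos)
    then have small: "norm (x *\<^sub>R u + y *\<^sub>R v) < min d r" if "0 \<le> x" "x \<le> t" "0 \<le> y" "y \<le> t" for x y
    proof -
      have "norm (x *\<^sub>R u + y *\<^sub>R v) \<le> x * norm u + y * norm v"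
        using norm_triangle_ineq[of "x *\<^sub>R u" "y *\<^sub>R v"] that by simp
      also have "\<dots> \<le> t * norm u + t * norm v"
        using that by (intro add_mono mult_right_mono) auto
      also have "\<dots> < min d r" using \<open>t * _ < _\<close> t by (simp add: algebra_simps)
      finally show ?thesis .
    qed
    have inS: "z + (x *\<^sub>R u + y *\<^sub>R v) \<in> S" if "0 \<le> x" "x \<le> t" "0 \<le> y" "y \<le> t" for x y
      proof -
      have "dist z (z + w) = norm w" for w by (simp add: dist_norm)
      then show ?thesis using small[OF that] by (intro subsetD[OF r(2)]) simp
    qed
    define g where "g x = f (z + (x *\<^sub>R u + t *\<^sub>R v)) - f (z + (x *\<^sub>R u + 0 *\<^sub>R v))" for x
    have der: "((\<lambda>x. f (z + (x *\<^sub>R u + y *\<^sub>R v))) has_derivative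
        (\<lambda>h. F (z + (x *\<^sub>R u + y *\<^sub>R v)) (h *\<^sub>R u))) (at x)"
      if "0 \<le> x" "x \<le> t" "0 \<le> y" "y \<le> t" for x y
      by (rule has_derivative_compose[of "\<lambda>x. z + (x *\<^sub>R u + y *\<^sub>R v)" _ x UNIV f, OF _ F[OF inS[OF that]]]) (auto intro!: derivative_eq_intros)
    have gder: "(g has_derivative (\<lambda>h. F (z + (x *\<^sub>R u + t *\<^sub>R v)) (h *\<^sub>R u) - F (z + (x *\<^sub>R u + 0 *\<^sub>R v)) (h *\<^sub>R u))) (at x)"
      if "0 \<le> x" "x \<le> t" for x
      unfolding g_def using that t by (intro has_derivative_diff der) auto
    obtain \<xi> where xi: "\<xi> \<in> {0<..<t}" and
      eq: "g t - g 0 = F (z + (\<xi> *\<^sub>R u + t *\<^sub>R v)) ((t - 0) *\<^sub>R u) - F (z + (\<xi> *\<^sub>R u + 0 *\<^sub>R v)) ((t - 0) *\<^sub>R u)"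
      using mvt_simple[OF t(1), of g] gder has_derivative_at_withinI
      by (smt (verit, best) atLeastAtMost_iff)
    have FS: "F (z + (\<xi> *\<^sub>R u + y *\<^sub>R v)) (t *\<^sub>R u) = t * F (z + (\<xi> *\<^sub>R u + y *\<^sub>R v)) u" if "0 \<le> y" "y \<le> t" for y
      using has_derivative_linear[OF F[OF inS[of \<xi> y]]] xi that by (auto simp: linear_cmul)
    define R where "R y = F (z + (\<xi> *\<^sub>R u + y *\<^sub>R v)) u - F z u - L (\<xi> *\<^sub>R u + y *\<^sub>R v)" for y
    have R: "\<bar>R y\<bar> \<le> c * norm (\<xi> *\<^sub>R u + y *\<^sub>R v)" if "0 \<le> y" "y \<le> t" for y
      using dL[of "z + (\<xi> *\<^sub>R u + y *\<^sub>R v)"] small[of \<xi> y] xi that by (auto simp: R_def)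
    have geq: "g t - g 0 = t * (R t - R 0) + t * t * L v"
      using eq FS[of t] FS[of 0] t unfolding R_def
      by (simp add: linear_add[OF Lin] linear_cmul[OF Lin] linear_0[OF Lin] algebra_simps)
    have quot: "(g t - g 0) / t\<^sup>2 - L v = (R t - R 0) / t"
      unfolding geq using t by (simp add: field_simps power2_eq_square)
    have "\<bar>R t - R 0\<bar> \<le> c * (t * (2 * norm u + norm v))"
    proof -
      have "\<bar>R t - R 0\<bar> \<le> c * norm (\<xi> *\<^sub>R u + t *\<^sub>R v) + c * norm (\<xi> *\<^sub>R u + 0 *\<^sub>R v)"
        using R[of t] R[of 0] t by linarith
      also have "\<dots> \<le> c * (\<xi> * norm u + t * norm v) + c * (\<xi> * norm u)"
        using norm_triangle_ineq[of "\<xi> *\<^sub>R u" "t *\<^sub>R v"] xi t c by (intro add_mono mult_left_mono) auto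
      also have "\<dots> \<le> c * (t * norm u + t * norm v) + c * (t * norm u)"
        using xi t c by (intro add_mono mult_left_mono mult_right_mono) auto
      finally show ?thesis by (simp add: algebra_simps)
    qed
    then have "\<bar>R t - R 0\<bar> / t \<le> c * (t * (2 * norm u + norm v)) / t"
      using t by (intro divide_right_mono) auto
    then have "\<bar>(g t - g 0) / t\<^sup>2 - L v\<bar> \<le> c * (2 * norm u + norm v)"
      unfolding quot using t by (simp add: abs_divide)
    also have "\<dots> < c * (2 * norm u + norm v + 1)"
      using c by simp
    also have "\<dots> = e"
      unfolding c_def by (simp add: add_nonneg_pos less_imp_neq[symmetric])
    finally show ?thesis by (simp add: dist_norm g_def algebra_simps)
  qed
  then show "\<forall>\<^sub>F t in at_right 0. dist ((f (z + t *\<^sub>R u + t *\<^sub>R v) - f (z + t *\<^sub>R u) - f (z + t *\<^sub>R v) + f z) / t\<^sup>2) (L v) < e"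
    unfolding eventually_at_right_field using b by blast
qed

lemma second_derivative_symmetric:
  fixes f :: "'a::real_normed_vector \<Rightarrow> 'b::real_inner"
  assumes S: "open S" "z \<in> S"
    and F: "\<And>x. x \<in> S \<Longrightarrow> (f has_derivative F x) (at x)"
    and L: "((\<lambda>x. F x u) has_derivative L) (at z)"
    and M: "((\<lambda>x. F x v) has_derivative M) (at z)"
  shows "L v = M u"
proof -
  have "L v \<bullet> b = M u \<bullet> b" for b
  proof -
    have F': "((\<lambda>x. f x \<bullet> b) has_derivative (\<lambda>h. F x h \<bullet> b)) (at x)" if "x \<in> S" for x
      by (intro has_derivative_inner_left F that)
    have "((\<lambda>t. (f (z + t *\<^sub>R u + t *\<^sub>R v) \<bullet> b - f (z + t *\<^sub>R u) \<bullet> b - f (z + t *\<^sub>R v) \<bullet> b + f z \<bullet> b) / t\<^sup>2) \<longlongrightarrow> L v \<bullet> b) (at_right 0)"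
      by (rule second_difference_tendsto[OF S F']) (auto intro!: has_derivative_inner_left L)
    moreover have "((\<lambda>t. (f (z + t *\<^sub>R v + t *\<^sub>R u) \<bullet> b - f (z + t *\<^sub>R v) \<bullet> b - f (z + t *\<^sub>R u) \<bullet> b + f z \<bullet> b) / t\<^sup>2) \<longlongrightarrow> M u \<bullet> b) (at_right 0)"
      by (rule second_difference_tendsto[OF S F']) (auto intro!: has_derivative_inner_left M)
    ultimately show ?thesis
      by (intro tendsto_unique[of "at_right (0::real)"]) (auto simp: add_ac diff_diff_eq2 algebra_simps)
  qed
  then show ?thesis by (metis inner_commute vector_eq_ldot)
qed

section \<open>Alternating sums over omitted arguments\<close>

definition omit :: "nat \<Rightarrow> 'v list \<Rightarrow> 'v list" where
  "omit i vs = take i vs @ drop (Suc i) vs"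

definition alt :: "('v \<Rightarrow> 'v list \<Rightarrow> complex) \<Rightarrow> 'v list \<Rightarrow> complex" where
  "alt T vs = (\<Sum>i<length vs. (-1) ^ i * T (vs ! i) (omit i vs))"

lemma wedge1_eq_alt: "wedge1 \<alpha> \<eta> = alt (\<lambda>u ws. \<alpha> u * \<eta> ws)"
  by (rule ext) (simp add: wedge1_def alt_def omit_def mult.assoc)

lemma alt_Nil [simp]: "alt T [] = 0"
  by (simp add: alt_def)

lemma alt_Cons: "alt T (v # vs) = T v vs - alt (\<lambda>u ws. T u (v # ws)) vs"
  by (simp add: alt_def omit_def sum.lessThan_Suc_shift sum_negf[symmetric] del: sum.lessThan_Suc)

lemma alt_linear: "alt (\<lambda>u ws. a * S u ws + b * T u ws) vs = a * alt S vs + b * alt T vs"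
  by (simp add: alt_def sum.distrib sum_distrib_left algebra_simps)

lemma alt_add: "alt (\<lambda>u ws. S u ws + T u ws) vs = alt S vs + alt T vs"
  using alt_linear[of 1 S 1 T vs] by simp

lemma alt_diff: "alt (\<lambda>u ws. S u ws - T u ws) vs = alt S vs - alt T vs"
  using alt_linear[of 1 S "-1" T vs] by simp

lemma alt_cmult: "alt (\<lambda>u ws. a * T u ws) vs = a * alt T vs"
  using alt_linear[of a T 0 T vs] by simp

lemma alt_sum: "alt (\<lambda>u ws. \<Sum>i\<in>I. T i u ws) vs = (\<Sum>i\<in>I. alt (T i) vs)"
  by (simp add: alt_def sum_distrib_left) (rule sum.swap)

lemma alt_alt_Cons:
  "alt (\<lambda>u. alt (Q u)) (v # vs) =
     alt (Q v) vs - alt (\<lambda>u. Q u v) vs + alt (\<lambda>u. alt (\<lambda>w ws. Q u w (v # ws))) vs"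
  by (simp add: alt_Cons alt_diff)

lemma alt_alt_antisym: "alt (\<lambda>u. alt (Q u)) vs = - alt (\<lambda>u. alt (\<lambda>v. Q v u)) vs"
proof (induction vs arbitrary: Q)
  case (Cons v vs)
  show ?case
    using Cons.IH[of "\<lambda>u w ws. Q u w (v # ws)"] by (simp add: alt_alt_Cons)
qed simp

lemma alt_alt_sym_zero:
  assumes "\<And>u v ws. Q u v ws = Q v u ws"
  shows "alt (\<lambda>u. alt (Q u)) vs = 0"
proof -
  have "(\<lambda>v. Q v u) = Q u" for u using assms by (intro ext)
  then show ?thesis using alt_alt_antisym[of Q vs] by simp
qed

lemma alt_wedge1_right: "alt (\<lambda>u. wedge1 \<alpha> (E u)) vs = - wedge1 \<alpha> (alt E) vs"
  unfolding wedge1_eq_alt by (subst alt_alt_antisym) (simp add: alt_cmult[abs_def])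

lemma alt_wedge1_left_zero:
  assumes "\<And>u v. a u v = a v u"
  shows "alt (\<lambda>u. wedge1 (a u) \<eta>) vs = 0"
  unfolding wedge1_eq_alt by (rule alt_alt_sym_zero) (metis assms)

lemma wedge1_antisym: "wedge1 \<alpha> (wedge1 \<beta> \<eta>) = (\<lambda>vs. - wedge1 \<beta> (wedge1 \<alpha> \<eta>) vs)"
proof
  fix vs
  show "wedge1 \<alpha> (wedge1 \<beta> \<eta>) vs = - wedge1 \<beta> (wedge1 \<alpha> \<eta>) vs"
    using alt_wedge1_right[of \<beta> "\<lambda>u ws. \<alpha> u * \<eta> ws" vs]
    by (simp add: wedge1_eq_alt alt_cmult[symmetric] mult.left_commute)
qed

lemma omit_map: "omit i (map L vs) = map L (omit i vs)"
  by (simp add: omit_def take_map drop_map)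

lemma alt_map: "alt T (map L vs) = alt (\<lambda>u ws. T (L u) (map L ws)) vs"
  by (simp add: alt_def omit_map)

lemma foldr_wedge1_map:
  "foldr wedge1 \<alpha>s unit_form (map L vs) = foldr wedge1 (map (\<lambda>\<alpha> u. \<alpha> (L u)) \<alpha>s) unit_form vs"
  by (induction \<alpha>s arbitrary: vs) (simp_all add: unit_form_def wedge1_eq_alt alt_map)

section \<open>Smooth functions and directional derivatives\<close>

lemma has_derivative_cong_open:
  assumes "open S" "z \<in> S" "\<And>x. x \<in> S \<Longrightarrow> f x = g x"
  shows "(f has_derivative D) (at z) \<longleftrightarrow> (g has_derivative D) (at z)"
  using has_derivative_transform_within_open[of f D z UNIV S g]
    has_derivative_transform_within_open[of g D z UNIV S f] assms by auto

lemma frechet_derivative_cong_open: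
  assumes "open S" "z \<in> S" "\<And>x. x \<in> S \<Longrightarrow> f x = g x"
  shows "frechet_derivative f (at z) = frechet_derivative g (at z)"
  unfolding frechet_derivative_def using has_derivative_cong_open[OF assms] by presburger

lemma differentiable_cong_open:
  assumes "open S" "z \<in> S" "\<And>x. x \<in> S \<Longrightarrow> f x = g x"
  shows "f differentiable at z \<longleftrightarrow> g differentiable at z"
  unfolding differentiable_def using has_derivative_cong_open[OF assms] by presburger

lemma frechet_derivative_eqI: "(f has_derivative D) (at z) \<Longrightarrow> frechet_derivative f (at z) = D"
  by (simp add: frechet_derivative_at[symmetric])

lemmas frechet_derivative_worksI = iffD1[OF frechet_derivative_works]

lemma frechet_derivative_bounded_linear:
  assumes "bounded_linear h" "f differentiable at z"
  shows "frechet_derivative (\<lambda>x. h (f x)) (at z) = (\<lambda>v. h (frechet_derivative f (at z) v))"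
  by (intro frechet_derivative_eqI bounded_linear.has_derivative[OF assms(1)])
    (rule frechet_derivative_worksI[OF assms(2)])

lemma frechet_derivative_plus:
  assumes "f differentiable at z" "g differentiable at z"
  shows "frechet_derivative (\<lambda>x. f x + g x) (at z) =
    (\<lambda>v. frechet_derivative f (at z) v + frechet_derivative g (at z) v)"
  by (intro frechet_derivative_eqI has_derivative_add) (intro frechet_derivative_worksI assms)+

lemma Ck_on_cong:
  assumes "open S" "\<And>x. x \<in> S \<Longrightarrow> f x = g x"
  shows "Ck_on k S f \<longleftrightarrow> Ck_on k S g"
  using assms(2)
proof (induction k arbitrary: f g)
  case (Suc k)
  have "Ck_on k S (\<lambda>x. frechet_derivative f (at x) v) \<longleftrightarrow> Ck_on k S (\<lambda>x. frechet_derivative g (at x) v)" for v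
    by (rule Suc.IH) (simp add: frechet_derivative_cong_open[OF assms(1) _ Suc.prems])
  moreover have "f differentiable at x \<longleftrightarrow> g differentiable at x" if "x \<in> S" for x
    by (rule differentiable_cong_open[OF assms(1) that Suc.prems])
  ultimately show ?case by simp
qed (use continuous_on_cong in auto)

lemma smooth_on_cong:
  assumes "open S" "\<And>x. x \<in> S \<Longrightarrow> f x = g x"
  shows "smooth_on S f \<longleftrightarrow> smooth_on S g"
  unfolding smooth_on_def using Ck_on_cong[OF assms] by simp

lemma Ck_on_bounded_linear:
  assumes "open S" "bounded_linear h"
  shows "Ck_on k S f \<Longrightarrow> Ck_on k S (\<lambda>x. h (f x))"
proof (induction k arbitrary: f)
  case 0
  then show ?case using bounded_linear.continuous_on[OF assms(2)] by simp
next
  case (Suc k)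
  have d: "(\<lambda>x. h (f x)) differentiable at x" if x: "x \<in> S" for x
  proof -
    obtain D where "(f has_derivative D) (at x)" using Suc.prems x by (auto simp: differentiable_def)
    from bounded_linear.has_derivative[OF assms(2) this] show ?thesis by (rule differentiableI)
  qed
  have "Ck_on k S (\<lambda>x. frechet_derivative (\<lambda>x. h (f x)) (at x) v)" for v
    by (subst Ck_on_cong[OF assms(1), where g="\<lambda>x. h (frechet_derivative f (at x) v)"])
      (use Suc in \<open>auto simp: frechet_derivative_bounded_linear[OF assms(2)]\<close>)
  then show ?case using d by simp
qed

lemma Ck_on_add:
  assumes "open S"
  shows "Ck_on k S f \<Longrightarrow> Ck_on k S g \<Longrightarrow> Ck_on k S (\<lambda>x. f x + g x)"
proof (induction k arbitrary: f g)
  case 0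
  then show ?case by (simp add: continuous_on_add)
next
  case (Suc k)
  have "Ck_on k S (\<lambda>x. frechet_derivative (\<lambda>x. f x + g x) (at x) v)" for v
    by (subst Ck_on_cong[OF assms, where g="\<lambda>x. frechet_derivative f (at x) v + frechet_derivative g (at x) v"])
      (use Suc in \<open>auto simp: frechet_derivative_plus\<close>)
  then show ?case using Suc.prems by simp
qed

lemma smooth_on_bounded_linear:
  "open S \<Longrightarrow> bounded_linear h \<Longrightarrow> smooth_on S f \<Longrightarrow> smooth_on S (\<lambda>x. h (f x))"
  by (simp add: smooth_on_def Ck_on_bounded_linear)

lemma smooth_on_add:
  "open S \<Longrightarrow> smooth_on S f \<Longrightarrow> smooth_on S g \<Longrightarrow> smooth_on S (\<lambda>x. f x + g x)"
  by (simp add: smooth_on_def Ck_on_add)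

lemma smooth_on_mult_left:
  fixes f :: "'a::euclidean_space \<Rightarrow> complex"
  shows "open S \<Longrightarrow> smooth_on S f \<Longrightarrow> smooth_on S (\<lambda>x. a * f x)"
  by (rule smooth_on_bounded_linear[OF _ bounded_linear_mult_right])

lemma smooth_on_zero: "smooth_on S (\<lambda>x. 0 :: 'b::real_normed_vector)"
proof -
  have "Ck_on k S (\<lambda>x. 0 :: 'b)" for k
    by (induction k) auto
  then show ?thesis by (simp add: smooth_on_def)
qed

lemma smooth_on_sum:
  assumes "open S" "\<And>i. i \<in> I \<Longrightarrow> smooth_on S (f i)"
  shows "smooth_on S (\<lambda>x. \<Sum>i\<in>I. f i x)"
  using assms(2) by (induction I rule: infinite_finite_induct) (auto simp: smooth_on_zero smooth_on_add assms(1))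

lemma smooth_on_frechet_derivative: "smooth_on S f \<Longrightarrow> smooth_on S (\<lambda>x. frechet_derivative f (at x) v)"
  by (metis smooth_on_def Ck_on.simps(2))

lemma smooth_on_differentiable: "smooth_on S f \<Longrightarrow> x \<in> S \<Longrightarrow> f differentiable at x"
  by (metis smooth_on_def Ck_on.simps(2))

lemma smooth_second_derivative_symmetric:
  fixes f :: "'a::euclidean_space \<Rightarrow> 'b::real_inner"
  assumes "open S" "z \<in> S" "smooth_on S f"
  shows "frechet_derivative (\<lambda>x. frechet_derivative f (at x) u) (at z) v =
    frechet_derivative (\<lambda>x. frechet_derivative f (at x) v) (at z) u"
  by (rule second_derivative_symmetric[OF assms(1,2), where f=f and F="\<lambda>x. frechet_derivative f (at x)"])
    (use frechet_derivative_worksI[OF smooth_on_differentiable[OF assms(3)]]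
      frechet_derivative_worksI[OF smooth_on_differentiable[OF smooth_on_frechet_derivative[OF assms(3)] assms(2)]]
      in simp_all)

definition pd :: "complex \<Rightarrow> complex^'n::finite \<Rightarrow> (complex^'n \<Rightarrow> complex) \<Rightarrow> complex^'n \<Rightarrow> complex" where
  "pd s v g z = (frechet_derivative g (at z) v + s * frechet_derivative g (at z) (\<i> *s v)) / 2"

lemma pd_cong_open:
  assumes "open S" "z \<in> S" "\<And>x. x \<in> S \<Longrightarrow> f x = g x"
  shows "pd s v f z = pd s v g z"
  unfolding pd_def using frechet_derivative_cong_open[OF assms] by simp

lemma pd_zero [simp]: "pd s v (\<lambda>x. 0) z = 0"
  by (simp add: pd_def)

lemma pd_add:
  assumes "f differentiable at z" "g differentiable at z"
  shows "pd s v (\<lambda>x. f x + g x) z = pd s v f z + pd s v g z"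
  by (simp add: pd_def frechet_derivative_plus[OF assms] algebra_simps add_divide_distrib)

lemma pd_mult_left:
  assumes "f differentiable at z"
  shows "pd s v (\<lambda>x. a * f x) z = a * pd s v f z"
  by (simp add: pd_def frechet_derivative_bounded_linear[OF bounded_linear_mult_right assms] algebra_simps)

lemma pd_sum:
  assumes "finite I" "\<And>i. i \<in> I \<Longrightarrow> f i differentiable at z"
  shows "pd s v (\<lambda>x. \<Sum>i\<in>I. f i x) z = (\<Sum>i\<in>I. pd s v (f i) z)"
  using assms
proof (induction I rule: finite_induct)
  case (insert i I)
  then have "(\<lambda>x. \<Sum>i\<in>I. f i x) differentiable at z" by (intro differentiable_sum) auto
  with insert show ?case by (simp add: pd_add)
qed simp

lemma pd_mult:
  assumes "f differentiable at z" "g differentiable at z"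
  shows "pd s v (\<lambda>x. f x * g x) z = pd s v f z * g z + f z * pd s v g z"
proof -
  have "frechet_derivative (\<lambda>x. f x * g x) (at z) =
      (\<lambda>v. f z * frechet_derivative g (at z) v + frechet_derivative f (at z) v * g z)"
    by (intro frechet_derivative_eqI has_derivative_mult) (intro frechet_derivative_worksI assms)+
  then show ?thesis by (simp add: pd_def algebra_simps add_divide_distrib)
qed

lemma pd_compose:
  assumes "\<phi> differentiable at z" "g differentiable at (\<phi> z)"
    and "frechet_derivative \<phi> (at z) (\<i> *s v) = \<i> *s frechet_derivative \<phi> (at z) v"
  shows "pd s v (\<lambda>x. g (\<phi> x)) z = pd s (frechet_derivative \<phi> (at z) v) g (\<phi> z)"
proof -
  have "frechet_derivative (\<lambda>x. g (\<phi> x)) (at z) = (\<lambda>v. frechet_derivative g (at (\<phi> z)) (frechet_derivative \<phi> (at z) v))"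
    by (intro frechet_derivative_eqI has_derivative_compose[of \<phi> _ z UNIV g])
      (intro frechet_derivative_worksI assms)+
  then show ?thesis by (simp add: pd_def assms(3))
qed

lemma pd_swap:
  assumes "open S" "z \<in> S" "smooth_on S g"
  shows "pd s u (pd t v g) z = pd t v (pd s u g) z"
proof -
  define H where "H a b = frechet_derivative (\<lambda>x. frechet_derivative g (at x) a) (at z) b" for a b
  have H: "H a b = H b a" for a b
    unfolding H_def by (rule smooth_second_derivative_symmetric[OF assms])
  have d: "(\<lambda>x. frechet_derivative g (at x) a) differentiable at z" for a
    by (rule smooth_on_differentiable[OF smooth_on_frechet_derivative[OF assms(3)] assms(2)])
  have one: "pd s u (\<lambda>x. frechet_derivative g (at x) a) z = (H a u + s * H a (\<i> *s u)) / 2" for s u a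
    by (simp add: pd_def H_def)
  have two: "pd s u (pd t v g) z =
     (H v u + s * H v (\<i> *s u) + t * (H (\<i> *s v) u + s * H (\<i> *s v) (\<i> *s u))) / 4" for s t u v
  proof -
    have "pd s u (pd t v g) z =
        pd s u (\<lambda>x. (1/2) * (frechet_derivative g (at x) v + t * frechet_derivative g (at x) (\<i> *s v))) z"
      by (simp add: pd_def[of t v, abs_def])
    also have "\<dots> = (1/2) * (pd s u (\<lambda>x. frechet_derivative g (at x) v) z
        + t * pd s u (\<lambda>x. frechet_derivative g (at x) (\<i> *s v)) z)"
      by (subst pd_mult_left pd_add; (intro derivative_intros d)?)+ simp
    finally show ?thesis unfolding one by (simp add: algebra_simps add_divide_distrib)
  qed
  show ?thesis
    unfolding two by (simp add: H[of v] H[of "\<i> *s v"] algebra_simps add_divide_distrib)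
qed

lemma smooth_on_pd:
  assumes "open S" "smooth_on S g"
  shows "smooth_on S (pd s v g)"
proof -
  have "smooth_on S (\<lambda>x. (1/2) * (frechet_derivative g (at x) v + s * frechet_derivative g (at x) (\<i> *s v)))"
    by (intro smooth_on_mult_left smooth_on_add smooth_on_frechet_derivative assms)
  then show ?thesis by (simp add: pd_def[abs_def])
qed

lemma wirtinger_eq_pd: "wirtinger j g = pd (-\<i>) (axis j 1) g"
  and wirtinger_bar_eq_pd: "wirtinger_bar j g = pd \<i> (axis j 1) g"
proof -
  have "\<i> *s axis j 1 = axis j \<i>" by (vector axis_def)
  then show "wirtinger j g = pd (-\<i>) (axis j 1) g" "wirtinger_bar j g = pd \<i> (axis j 1) g"
    by (auto simp: wirtinger_def wirtinger_bar_def pd_def)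
qed

lemma linear_axis_expansion:
  fixes D :: "complex^'n::finite \<Rightarrow> complex"
  assumes "linear D"
  shows "D v = (\<Sum>j\<in>UNIV. Re (v $ j) * D (axis j 1) + Im (v $ j) * D (axis j \<i>))"
proof -
  have "v = (\<Sum>j\<in>UNIV. Re (v $ j) *\<^sub>R axis j 1 + Im (v $ j) *\<^sub>R axis j \<i>)"
    by (simp add: vec_eq_iff axis_def if_distrib sum.distrib cong: if_cong)
      (simp add: complex_eq_iff)
  then have "D v = D (\<Sum>j\<in>UNIV. Re (v $ j) *\<^sub>R axis j 1 + Im (v $ j) *\<^sub>R axis j \<i>)" by simp
  also have "\<dots> = (\<Sum>j\<in>UNIV. Re (v $ j) * D (axis j 1) + Im (v $ j) * D (axis j \<i>))"
    by (simp only: linear_sum[OF assms] linear_add[OF assms] linear_cmul[OF assms] scaleR_conv_of_real[where 'a=complex])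
  finally show ?thesis .
qed

lemma pd_eq_sum_wirtinger:
  assumes "g differentiable at z"
  shows "pd (-\<i>) v g z = (\<Sum>j\<in>UNIV. dz j v * wirtinger j g z)"
    and "pd \<i> v g z = (\<Sum>j\<in>UNIV. dzbar j v * wirtinger_bar j g z)"
proof -
  let ?D = "frechet_derivative g (at z)"
  have lin: "linear ?D" by (rule linear_frechet_derivative[OF assms])
  have "(Re w * a + Im w * b + (-\<i>) * (Re (\<i> * w) * a + Im (\<i> * w) * b)) / 2 = w * ((a - \<i> * b) / 2)"
    and "(Re w * a + Im w * b + \<i> * (Re (\<i> * w) * a + Im (\<i> * w) * b)) / 2 = cnj w * ((a + \<i> * b) / 2)"
    for w a b :: complex
    by (simp_all add: complex_eq_iff algebra_simps)
  note e = this[symmetric]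
  show "pd (-\<i>) v g z = (\<Sum>j\<in>UNIV. dz j v * wirtinger j g z)"
    unfolding pd_def linear_axis_expansion[OF lin, of v] linear_axis_expansion[OF lin, of "\<i> *s v"]
      wirtinger_def dz_def e
    by (simp only: sum_distrib_left sum.distrib[symmetric] sum_divide_distrib vector_smult_component)
  show "pd \<i> v g z = (\<Sum>j\<in>UNIV. dzbar j v * wirtinger_bar j g z)"
    unfolding pd_def linear_axis_expansion[OF lin, of v] linear_axis_expansion[OF lin, of "\<i> *s v"]
      wirtinger_bar_def dzbar_def e
    by (simp only: sum_distrib_left sum.distrib[symmetric] sum_divide_distrib vector_smult_component)
qed

section \<open>Local forms and their pullback\<close>

definition Del :: "complex \<Rightarrow> (complex^'n::finite \<Rightarrow> (complex^'n) list \<Rightarrow> complex) \<Rightarrow> complex^'n \<Rightarrow> (complex^'n) list \<Rightarrow> complex" where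
  "Del s \<eta> z = alt (\<lambda>u ws. pd s u (\<lambda>x. \<eta> x ws) z)"

lemma pd_alt:
  assumes "\<And>u ws. (\<lambda>x. T x u ws) differentiable at z"
  shows "pd s v (\<lambda>x. alt (T x) vs) z = alt (\<lambda>u ws. pd s v (\<lambda>x. T x u ws) z) vs"
  unfolding alt_def by (subst pd_sum pd_mult_left; (intro finite_lessThan derivative_intros assms)?)+ simp

lemma Del_Del:
  assumes U: "open U" "z \<in> U" and \<eta>: "\<And>ws. smooth_on U (\<lambda>x. \<eta> x ws)"
    and \<theta>: "\<And>x. x \<in> U \<Longrightarrow> \<theta> x = Del t \<eta> x"
  shows "Del s \<theta> z = alt (\<lambda>u. alt (\<lambda>v us. pd s u (pd t v (\<lambda>y. \<eta> y us)) z))"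
proof -
  have "pd s u (\<lambda>x. \<theta> x ws) z = alt (\<lambda>v us. pd s u (pd t v (\<lambda>y. \<eta> y us)) z) ws" for u ws
  proof -
    have "pd s u (\<lambda>x. \<theta> x ws) z = pd s u (\<lambda>x. alt (\<lambda>v us. pd t v (\<lambda>y. \<eta> y us) x) ws) z"
      by (rule pd_cong_open[OF U]) (simp add: \<theta> Del_def)
    also have "\<dots> = alt (\<lambda>v us. pd s u (pd t v (\<lambda>y. \<eta> y us)) z) ws"
      by (rule pd_alt) (rule smooth_on_differentiable[OF smooth_on_pd[OF U(1) \<eta>] U(2)])
    finally show ?thesis .
  qed
  then show ?thesis by (simp add: Del_def[of s])
qed

lemma Del_anticommute:
  assumes U: "open U" "z \<in> U" and \<eta>: "\<And>ws. smooth_on U (\<lambda>x. \<eta> x ws)"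
    and \<theta>: "\<And>x. x \<in> U \<Longrightarrow> \<theta> x = Del t \<eta> x" and \<theta>': "\<And>x. x \<in> U \<Longrightarrow> \<theta>' x = Del s \<eta> x"
  shows "Del s \<theta> z vs = - Del t \<theta>' z vs"
proof -
  have "Del s \<theta> z = alt (\<lambda>u. alt (\<lambda>v us. pd s u (pd t v (\<lambda>y. \<eta> y us)) z))"
    by (rule Del_Del[OF U \<eta> \<theta>])
  then have "Del s \<theta> z vs = - alt (\<lambda>u. alt (\<lambda>v us. pd s v (pd t u (\<lambda>y. \<eta> y us)) z)) vs"
    by (simp only: alt_alt_antisym[of "\<lambda>u v us. pd s u (pd t v (\<lambda>y. \<eta> y us)) z"])
  also have "pd s v (pd t u (\<lambda>y. \<eta> y us)) z = pd t u (pd s v (\<lambda>y. \<eta> y us)) z" for u v us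
    by (rule pd_swap[OF U \<eta>])
  then have "alt (\<lambda>u. alt (\<lambda>v us. pd s v (pd t u (\<lambda>y. \<eta> y us)) z)) vs =
      alt (\<lambda>u. alt (\<lambda>v us. pd t u (pd s v (\<lambda>y. \<eta> y us)) z)) vs"
    by (simp only:)
  also have "alt (\<lambda>u. alt (\<lambda>v us. pd t u (pd s v (\<lambda>y. \<eta> y us)) z)) = Del t \<theta>' z"
    by (rule Del_Del[OF U \<eta> \<theta>', symmetric])
  finally show ?thesis .
qed

lemma wedge1_sum_left:
  "wedge1 (\<lambda>u. \<Sum>i\<in>I. a i * \<alpha> i u) \<eta> vs = (\<Sum>i\<in>I. a i * wedge1 (\<alpha> i) \<eta> vs)"
  unfolding wedge1_eq_alt by (simp add: sum_distrib_right alt_sum alt_cmult mult.assoc)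

lemma wedge1_cmult_right: "wedge1 \<alpha> (\<lambda>vs. a * \<eta> vs) vs = a * wedge1 \<alpha> \<eta> vs"
  unfolding wedge1_eq_alt by (simp add: mult.left_commute alt_cmult)

lemma wedge1_zero_right: "wedge1 \<alpha> (\<lambda>vs. 0) vs = 0"
  by (simp add: wedge1_def)

lemma finite_multi_indices [simp]: "finite {I :: 'n::finite list. length I = p}"
  using finite_lists_length_eq[of "UNIV :: 'n set" p] by simp

lemma sum_multi_indices_Suc:
  "(\<Sum>K\<in>{K :: 'n::finite list. length K = Suc p}. g K) = (\<Sum>j\<in>UNIV. \<Sum>I\<in>{I. length I = p}. g (j # I))"
proof -
  have "(\<Sum>K\<in>{K :: 'n list. length K = Suc p}. g K)
      = (\<Sum>(j, I)\<in>UNIV \<times> {I. length I = p}. g (j # I))"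
    by (rule sum.reindex_bij_witness[where i="\<lambda>(j, I). j # I" and j="\<lambda>K. (hd K, tl K)"])
      (auto simp: length_Suc_conv)
  then show ?thesis by (simp add: sum.cartesian_product)
qed

lemma wedge1_dz_dzbar: "wedge1 (dz j) (dz_dzbar I J) = dz_dzbar (j # I) J"
  by (simp add: dz_dzbar_def)

lemma wedge1_dzbar_dz_dzbar:
  "wedge1 (dzbar j) (dz_dzbar I J) vs = (-1) ^ length I * dz_dzbar I (j # J) vs"
proof (induction I arbitrary: vs)
  case (Cons i I)
  have "wedge1 (dzbar j) (dz_dzbar (i # I) J) vs = - wedge1 (dz i) (wedge1 (dzbar j) (dz_dzbar I J)) vs"
    by (simp add: wedge1_dz_dzbar[symmetric] wedge1_antisym[of "dzbar j"])
  also have "wedge1 (dzbar j) (dz_dzbar I J) = (\<lambda>vs. (-1) ^ length I * dz_dzbar I (j # J) vs)"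
    by (rule ext) (rule Cons.IH)
  finally show ?case by (simp add: wedge1_cmult_right wedge1_dz_dzbar)
qed (simp add: dz_dzbar_def)

lemma local_form_smooth:
  assumes "open U" "local_form p q U \<eta>"
  shows "smooth_on U (\<lambda>x. \<eta> x ws)"
proof -
  obtain f where f: "\<And>I J. smooth_on U (f I J)" and \<eta>: "\<And>z vs. z \<in> U \<Longrightarrow> \<eta> z vs =
      (\<Sum>I\<in>{I. length I = p}. \<Sum>J\<in>{J. length J = q}. f I J z * dz_dzbar I J vs)"
    using assms(2) unfolding local_form_def by blast
  have "smooth_on U (\<lambda>x. \<Sum>I\<in>{I. length I = p}. \<Sum>J\<in>{J. length J = q}. dz_dzbar I J ws * f I J x)"
    by (intro smooth_on_sum smooth_on_mult_left assms f)
  then show ?thesis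
    by (subst smooth_on_cong[OF assms(1) \<eta>]) (simp_all add: mult.commute)
qed

lemma Del_expand:
  assumes U: "open U" "z \<in> U" and f: "\<And>I J. smooth_on U (f I J)"
    and \<eta>: "\<And>x vs. x \<in> U \<Longrightarrow> \<eta> x vs =
      (\<Sum>I\<in>{I. length I = p}. \<Sum>J\<in>{J. length J = q}. f I J x * dz_dzbar I J vs)"
  shows "Del s \<eta> z vs = (\<Sum>I\<in>{I. length I = p}. \<Sum>J\<in>{J. length J = q}.
      wedge1 (\<lambda>u. pd s u (f I J) z) (dz_dzbar I J) vs)"
proof -
  have d: "f I J differentiable at z" for I J
    by (rule smooth_on_differentiable[OF f U(2)])
  have "pd s u (\<lambda>x. \<eta> x ws) z = (\<Sum>I\<in>{I. length I = p}. \<Sum>J\<in>{J. length J = q}.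
      pd s u (f I J) z * dz_dzbar I J ws)" for u ws
  proof -
    have "pd s u (\<lambda>x. \<eta> x ws) z = pd s u (\<lambda>x. \<Sum>I\<in>{I. length I = p}. \<Sum>J\<in>{J. length J = q}.
        dz_dzbar I J ws * f I J x) z"
      by (rule pd_cong_open[OF U]) (simp add: \<eta> mult.commute)
    also have "\<dots> = (\<Sum>I\<in>{I. length I = p}. \<Sum>J\<in>{J. length J = q}. dz_dzbar I J ws * pd s u (f I J) z)"
      by (simp add: pd_sum pd_mult_left d)
    finally show ?thesis by (simp add: mult.commute)
  qed
  then show ?thesis by (simp add: Del_def alt_sum wedge1_eq_alt)
qed

lemma local_form_Del:
  assumes U: "open U" and \<eta>: "local_form p q U \<eta>"
  shows "(\<And>z. z \<in> U \<Longrightarrow> \<theta> z = Del (-\<i>) \<eta> z) \<Longrightarrow> local_form (Suc p) q U \<theta>"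
    and "(\<And>z. z \<in> U \<Longrightarrow> \<theta> z = Del \<i> \<eta> z) \<Longrightarrow> local_form p (Suc q) U \<theta>"
proof -
  obtain f where f: "\<And>I J. smooth_on U (f I J)" and ex: "\<And>z vs. z \<in> U \<Longrightarrow> \<eta> z vs =
      (\<Sum>I\<in>{I. length I = p}. \<Sum>J\<in>{J. length J = q}. f I J z * dz_dzbar I J vs)"
    using \<eta> unfolding local_form_def by blast
  have d: "f I J differentiable at z" if "z \<in> U" for I J z
    by (rule smooth_on_differentiable[OF f that])
  have De: "Del s \<eta> z vs = (\<Sum>I\<in>{I. length I = p}. \<Sum>J\<in>{J. length J = q}.
      wedge1 (\<lambda>u. pd s u (f I J) z) (dz_dzbar I J) vs)" if "z \<in> U" for s z vs
    by (rule Del_expand[OF U that f ex])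
  {
    assume \<theta>: "\<And>z. z \<in> U \<Longrightarrow> \<theta> z = Del (-\<i>) \<eta> z"
    have "\<theta> z vs = (\<Sum>K\<in>{K. length K = Suc p}. \<Sum>J\<in>{J. length J = q}.
        wirtinger (hd K) (f (tl K) J) z * dz_dzbar K J vs)" if z: "z \<in> U" for z vs
    proof -
      have "\<theta> z vs = (\<Sum>I\<in>{I. length I = p}. \<Sum>J\<in>{J. length J = q}. \<Sum>j\<in>UNIV.
          wirtinger j (f I J) z * dz_dzbar (j # I) J vs)"
        unfolding \<theta>[OF z] De[OF z] pd_eq_sum_wirtinger(1)[OF d[OF z]]
        by (simp add: mult.commute[of "dz _ _"] wedge1_sum_left wedge1_dz_dzbar)
      also have "\<dots> = (\<Sum>j\<in>UNIV. \<Sum>I\<in>{I. length I = p}. \<Sum>J\<in>{J. length J = q}.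
          wirtinger j (f I J) z * dz_dzbar (j # I) J vs)"
        by (subst sum.swap) (subst (2) sum.swap, rule refl)
      finally show ?thesis by (simp add: sum_multi_indices_Suc)
    qed
    then show "local_form (Suc p) q U \<theta>"
      unfolding local_form_def
      by (intro exI[of _ "\<lambda>K J. wirtinger (hd K) (f (tl K) J)"])
        (simp add: wirtinger_eq_pd smooth_on_pd[OF U f])
  next
    assume \<theta>: "\<And>z. z \<in> U \<Longrightarrow> \<theta> z = Del \<i> \<eta> z"
    have "\<theta> z vs = (\<Sum>I\<in>{I. length I = p}. \<Sum>K\<in>{K. length K = Suc q}.
        (-1) ^ p * wirtinger_bar (hd K) (f I (tl K)) z * dz_dzbar I K vs)" if z: "z \<in> U" for z vs
    proof -
      have "\<theta> z vs = (\<Sum>I\<in>{I. length I = p}. \<Sum>J\<in>{J. length J = q}. \<Sum>j\<in>UNIV.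
          wirtinger_bar j (f I J) z * ((-1) ^ length I * dz_dzbar I (j # J) vs))"
        unfolding \<theta>[OF z] De[OF z] pd_eq_sum_wirtinger(2)[OF d[OF z]]
        by (simp add: mult.commute[of "dzbar _ _"] wedge1_sum_left wedge1_dzbar_dz_dzbar)
      also have "\<dots> = (\<Sum>I\<in>{I. length I = p}. \<Sum>j\<in>UNIV. \<Sum>J\<in>{J. length J = q}.
          wirtinger_bar j (f I J) z * ((-1) ^ length I * dz_dzbar I (j # J) vs))"
        by (subst (2) sum.swap) (rule refl)
      finally show ?thesis by (simp add: sum_multi_indices_Suc mult_ac)
    qed
    then show "local_form p (Suc q) U \<theta>"
      unfolding local_form_def
      by (intro exI[of _ "\<lambda>I K z. (-1) ^ p * wirtinger_bar (hd K) (f I (tl K)) z"])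
        (simp add: wirtinger_bar_eq_pd smooth_on_mult_left smooth_on_pd[OF U f] U)
  }
qed

lemma foldr_wedge1_differentiable:
  assumes "\<And>\<alpha> v. \<alpha> \<in> set \<alpha>s \<Longrightarrow> (\<lambda>x. \<alpha> x v) differentiable at z"
  shows "(\<lambda>x. foldr wedge1 (map (\<lambda>\<alpha>. \<alpha> x) \<alpha>s) unit_form ws) differentiable at z"
  using assms
proof (induction \<alpha>s arbitrary: ws)
  case (Cons \<alpha> \<alpha>s)
  then show ?case
    by (simp add: wedge1_def)
qed simp

text \<open>Because of this, the second derivatives of the transition maps drop out of the transformation
  rule for \<open>Del\<close>.\<close>

lemma Del_foldr_wedge1_closed:
  assumes "\<And>\<alpha> v. \<alpha> \<in> set \<alpha>s \<Longrightarrow> (\<lambda>x. \<alpha> x v) differentiable at z"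
    and "\<And>\<alpha> u v. \<alpha> \<in> set \<alpha>s \<Longrightarrow> pd s u (\<lambda>x. \<alpha> x v) z = pd s v (\<lambda>x. \<alpha> x u) z"
  shows "Del s (\<lambda>x. foldr wedge1 (map (\<lambda>\<alpha>. \<alpha> x) \<alpha>s) unit_form) z vs = 0"
  using assms
proof (induction \<alpha>s arbitrary: vs)
  case Nil
  have "pd s u (\<lambda>x. unit_form ws) z = 0" for u and ws :: "(complex^'a) list"
    by (simp add: pd_def)
  then show ?case using alt_cmult[of 0 _ vs] by (simp add: Del_def)
next
  case (Cons \<alpha> \<alpha>s)
  define \<eta> where "\<eta> x = foldr wedge1 (map (\<lambda>\<alpha>. \<alpha> x) \<alpha>s) unit_form" for x
  have d: "(\<lambda>x. \<alpha> x v) differentiable at z" "(\<lambda>x. \<eta> x ws) differentiable at z" for v ws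
    using Cons.prems foldr_wedge1_differentiable[of \<alpha>s z] by (auto simp: \<eta>_def)
  have "pd s u (\<lambda>x. wedge1 (\<alpha> x) (\<eta> x) ws) z =
      wedge1 (\<lambda>v. pd s u (\<lambda>x. \<alpha> x v) z) (\<eta> z) ws + wedge1 (\<alpha> z) (\<lambda>us. pd s u (\<lambda>x. \<eta> x us) z) ws" for u ws
    unfolding wedge1_eq_alt
    by (subst pd_alt) (simp_all add: d pd_mult alt_add)
  then have "Del s (\<lambda>x. wedge1 (\<alpha> x) (\<eta> x)) z vs =
      alt (\<lambda>u. wedge1 (\<lambda>v. pd s u (\<lambda>x. \<alpha> x v) z) (\<eta> z)) vs
      + alt (\<lambda>u. wedge1 (\<alpha> z) (\<lambda>us. pd s u (\<lambda>x. \<eta> x us) z)) vs"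
    by (simp add: Del_def alt_add)
  also have "\<dots> = - wedge1 (\<alpha> z) (Del s \<eta> z) vs"
    by (subst alt_wedge1_left_zero) (use Cons.prems in \<open>simp_all add: alt_wedge1_right Del_def\<close>)
  also have "Del s \<eta> z = (\<lambda>us. 0 * Del s \<eta> z us)"
    using Cons.IH Cons.prems by (intro ext) (simp add: \<eta>_def[abs_def])
  finally show ?case by (simp add: wedge1_cmult_right \<eta>_def[abs_def] wedge1_zero_right)
qed

lemma holomorphic_component_closed:
  fixes \<phi> :: "complex^'n::finite \<Rightarrow> complex^'n" and i :: 'n
  assumes S: "open S" "z \<in> S" and \<phi>: "holomorphic_map_on S \<phi>" and h: "h = (\<lambda>w. w) \<or> h = cnj"
  defines "\<alpha> \<equiv> \<lambda>x v. h (frechet_derivative \<phi> (at x) v $ i)"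
  shows "(\<lambda>x. \<alpha> x v) differentiable at z" "pd s u (\<lambda>x. \<alpha> x v) z = pd s v (\<lambda>x. \<alpha> x u) z"
proof -
  have sm: "smooth_on S \<phi>" and hol: "\<And>x a v. x \<in> S \<Longrightarrow>
      frechet_derivative \<phi> (at x) (a *s v) = a *s frechet_derivative \<phi> (at x) v"
    using \<phi> by (auto simp: holomorphic_map_on_def)
  have bh: "bounded_linear h" using h bounded_linear_cnj bounded_linear_ident by auto
  have bl: "bounded_linear (\<lambda>w :: complex^'n. w $ i)" by (rule bounded_linear_vec_nth)
  define G where "G v x = frechet_derivative \<phi> (at x) v $ i" for v x
  have smG: "smooth_on S (G v)" for v
    unfolding G_def by (intro smooth_on_bounded_linear[OF S(1) bl] smooth_on_frechet_derivative sm)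
  then have dG: "G v differentiable at z" for v by (rule smooth_on_differentiable[OF _ S(2)])
  have "smooth_on S (\<lambda>x. \<alpha> x v)"
    using smooth_on_bounded_linear[OF S(1) bh smG] by (simp add: \<alpha>_def G_def)
  then show "(\<lambda>x. \<alpha> x v) differentiable at z" by (rule smooth_on_differentiable[OF _ S(2)])
  define H where "H v u = frechet_derivative (G v) (at z) u" for v u
  have Hsym: "H v u = H u v" for u v
  proof -
    have "H v u = frechet_derivative (\<lambda>x. frechet_derivative \<phi> (at x) v) (at z) u $ i" for u v
      unfolding H_def G_def
      by (subst frechet_derivative_bounded_linear[OF bl smooth_on_differentiable[OF smooth_on_frechet_derivative[OF sm] S(2)]]) simp
    then show ?thesis using smooth_second_derivative_symmetric[OF S sm] by simp
  qed
  have Hi: "H v (\<i> *s u) = \<i> * H v u" for u v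
  proof -
    have "H v (\<i> *s u) = frechet_derivative (G (\<i> *s u)) (at z) v"
      by (subst Hsym) (simp add: H_def)
    also have "\<dots> = frechet_derivative (\<lambda>x. \<i> * G u x) (at z) v"
      by (subst frechet_derivative_cong_open[OF S, where g="\<lambda>x. \<i> * G u x"]) (simp_all add: G_def hol)
    also have "\<dots> = \<i> * H u v"
      by (simp add: frechet_derivative_bounded_linear[OF bounded_linear_mult_right dG] H_def)
    finally show ?thesis by (simp add: Hsym)
  qed
  have P: "pd s u (\<lambda>x. \<alpha> x v) z = (h (H v u) + s * h (\<i> * H v u)) / 2" for u v
    using frechet_derivative_bounded_linear[OF bh dG[of v]]
    by (simp add: pd_def \<alpha>_def G_def[symmetric] H_def[symmetric] Hi)
  show "pd s u (\<lambda>x. \<alpha> x v) z = pd s v (\<lambda>x. \<alpha> x u) z"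
    unfolding P Hsym[of u v] by (rule refl)
qed

lemma Del_pullback:
  fixes \<phi> :: "complex^'n::finite \<Rightarrow> complex^'n"
  assumes S: "open S" "z \<in> S" and U: "open U" and \<phi>: "holomorphic_map_on S \<phi>" "\<phi> ` S \<subseteq> U"
    and \<eta>: "local_form p q U \<eta>"
    and \<zeta>: "\<And>x ws. x \<in> S \<Longrightarrow> \<zeta> x ws = \<eta> (\<phi> x) (map (frechet_derivative \<phi> (at x)) ws)"
  shows "Del s \<zeta> z vs = Del s \<eta> (\<phi> z) (map (frechet_derivative \<phi> (at z)) vs)"
proof -
  obtain f where f: "\<And>I J. smooth_on U (f I J)" and ex: "\<And>z vs. z \<in> U \<Longrightarrow> \<eta> z vs =
      (\<Sum>I\<in>{I. length I = p}. \<Sum>J\<in>{J. length J = q}. f I J z * dz_dzbar I J vs)"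
    using \<eta> unfolding local_form_def by blast
  let ?L = "\<lambda>x. frechet_derivative \<phi> (at x)"
  have phiz: "\<phi> z \<in> U" using \<phi>(2) S(2) by auto
  have sm: "smooth_on S \<phi>" and hol: "\<And>x a v. x \<in> S \<Longrightarrow> ?L x (a *s v) = a *s ?L x v"
    using \<phi> by (auto simp: holomorphic_map_on_def)
  have d\<phi>: "\<phi> differentiable at z" by (rule smooth_on_differentiable[OF sm S(2)])
  have df: "f I J differentiable at (\<phi> z)" for I J by (rule smooth_on_differentiable[OF f phiz])
  have dc: "(\<lambda>x. f I J (\<phi> x)) differentiable at z" for I J
    using differentiable_chain_at[OF d\<phi> df] by (simp add: o_def)
  define W where "W I J x ws = dz_dzbar I J (map (?L x) ws)" for I J x ws
  define \<alpha>s where "\<alpha>s I J = map (\<lambda>i x v. ?L x v $ i) I @ map (\<lambda>i x v. cnj (?L x v $ i)) J" for I J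
  have W: "W I J x = foldr wedge1 (map (\<lambda>\<alpha>. \<alpha> x) (\<alpha>s I J)) unit_form" for I J x
    by (rule ext) (simp add: W_def dz_dzbar_def foldr_wedge1_map \<alpha>s_def comp_def dz_def dzbar_def del: foldr_append)
  have a: "(\<lambda>x. \<alpha> x v) differentiable at z" "pd s u (\<lambda>x. \<alpha> x v) z = pd s v (\<lambda>x. \<alpha> x u) z"
    if "\<alpha> \<in> set (\<alpha>s I J)" for \<alpha> u v I J
    using that holomorphic_component_closed[where h="\<lambda>w. w", OF S \<phi>(1)]
      holomorphic_component_closed[where h=cnj, OF S \<phi>(1)] by (auto simp: \<alpha>s_def)
  have dW: "(\<lambda>x. W I J x ws) differentiable at z" for I J ws
    unfolding W by (rule foldr_wedge1_differentiable) (rule a)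
  have DW: "Del s (W I J) z vs = 0" for I J
    unfolding W[abs_def] by (rule Del_foldr_wedge1_closed) (rule a, assumption)+
  have "pd s u (\<lambda>x. \<zeta> x ws) z = (\<Sum>I\<in>{I. length I = p}. \<Sum>J\<in>{J. length J = q}.
      pd s (?L z u) (f I J) (\<phi> z) * W I J z ws + f I J (\<phi> z) * pd s u (\<lambda>x. W I J x ws) z)" for u ws
  proof -
    have "pd s u (\<lambda>x. \<zeta> x ws) z = pd s u (\<lambda>x. \<Sum>I\<in>{I. length I = p}. \<Sum>J\<in>{J. length J = q}.
        f I J (\<phi> x) * W I J x ws) z"
      by (rule pd_cong_open[OF S]) (use \<phi>(2) in \<open>auto simp: \<zeta> ex W_def\<close>)
    also have "\<dots> = (\<Sum>I\<in>{I. length I = p}. \<Sum>J\<in>{J. length J = q}.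
        pd s u (\<lambda>x. f I J (\<phi> x) * W I J x ws) z)"
      by (simp add: pd_sum dc dW)
    finally show ?thesis
      by (simp add: pd_mult dc dW pd_compose[OF d\<phi> df hol[OF S(2)]])
  qed
  then have "Del s \<zeta> z vs = (\<Sum>I\<in>{I. length I = p}. \<Sum>J\<in>{J. length J = q}.
      alt (\<lambda>u ws. pd s (?L z u) (f I J) (\<phi> z) * W I J z ws) vs + f I J (\<phi> z) * Del s (W I J) z vs)"
    by (simp add: Del_def alt_sum alt_add alt_cmult)
  also have "\<dots> = (\<Sum>I\<in>{I. length I = p}. \<Sum>J\<in>{J. length J = q}.
      wedge1 (\<lambda>u. pd s u (f I J) (\<phi> z)) (dz_dzbar I J) (map (?L z) vs))"
    by (simp add: DW wedge1_eq_alt alt_map W_def)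
  also have "\<dots> = Del s \<eta> (\<phi> z) (map (?L z) vs)"
    by (rule Del_expand[OF U phiz f ex, symmetric])
  finally show ?thesis .
qed

section \<open>The double complex of forms\<close>

lemma complex_chart_inj:
  assumes "complex_chart X c"
  shows "inj_on (snd c) (fst c)"
proof -
  have "topspace (subtopology X (fst c)) = fst c"
    using assms openin_subset[of X "fst c"] by (auto simp: complex_chart_def)
  then show ?thesis
    using assms homeomorphic_imp_injective_map unfolding complex_chart_def by metis
qed

lemma open_overlap:
  assumes "complex_chart X c" "openin X (fst d)"
  shows "open (overlap c d)"
proof -
  have "open_map (subtopology X (fst c)) (top_of_set (chart_image c)) (snd c)"
    using assms(1) homeomorphic_imp_open_map unfolding complex_chart_def by blast
  moreover have "openin (subtopology X (fst c)) (fst c \<inter> fst d)"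
    using assms(2) by (auto simp: openin_subtopology)
  ultimately have "openin (top_of_set (chart_image c)) (overlap c d)"
    unfolding open_map_def overlap_def by blast
  then show ?thesis
    using assms(1) openin_open_trans unfolding complex_chart_def by blast
qed

lemma overlap_subset: "overlap c d \<subseteq> chart_image c"
  by (auto simp: overlap_def chart_image_def)

lemma transition_in_chart_image:
  assumes "complex_chart X c" "z \<in> overlap c d"
  shows "transition c d z \<in> chart_image d"
  using assms complex_chart_inj[OF assms(1)]
  by (auto simp: overlap_def transition_def chart_image_def)

lemma atlas_facts:
  assumes "complex_atlas X A" "c \<in> A"
  shows "complex_chart X c" "open (chart_image c)"
    "d \<in> A \<Longrightarrow> open (overlap c d)" "d \<in> A \<Longrightarrow> holomorphic_map_on (overlap c d) (transition c d)"
  using assms open_overlap[of X c d] by (auto simp: complex_atlas_def complex_chart_def)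

lemma local_form_zero: "local_form p q U (\<lambda>z vs. 0)"
  unfolding local_form_def by (intro exI[of _ "\<lambda>I J z. 0"]) (simp add: smooth_on_zero)

lemma local_form_linear:
  assumes U: "open U" and "local_form p q U \<omega>" "local_form p q U \<eta>"
  shows "local_form p q U (\<lambda>z vs. a * \<omega> z vs + b * \<eta> z vs)"
proof -
  obtain f where f: "\<And>I J. smooth_on U (f I J)" "\<And>z vs. z \<in> U \<Longrightarrow> \<omega> z vs =
      (\<Sum>I\<in>{I. length I = p}. \<Sum>J\<in>{J. length J = q}. f I J z * dz_dzbar I J vs)"
    using assms(2) unfolding local_form_def by blast
  obtain g where g: "\<And>I J. smooth_on U (g I J)" "\<And>z vs. z \<in> U \<Longrightarrow> \<eta> z vs =
      (\<Sum>I\<in>{I. length I = p}. \<Sum>J\<in>{J. length J = q}. g I J z * dz_dzbar I J vs)"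
    using assms(3) unfolding local_form_def by blast
  show ?thesis
    unfolding local_form_def
    by (intro exI[of _ "\<lambda>I J z. a * f I J z + b * g I J z"])
      (auto simp: f g U smooth_on_add smooth_on_mult_left sum_distrib_left sum.distrib[symmetric] algebra_simps
        simp del: sum.distrib intro!: sum.cong)
qed

lemma zero_in_forms: "0 \<in> forms A p q"
  using local_form_zero by (auto simp: forms_def zero_fun_def)

lemma forms_linear:
  assumes "complex_atlas X A" "\<omega> \<in> forms A p q" "\<eta> \<in> forms A p q"
  shows "(\<lambda>c z vs. a * \<omega> c z vs + b * \<eta> c z vs) \<in> forms A p q"
proof (cases "0 \<le> p \<and> 0 \<le> q")
  case True
  then have "local_form (nat p) (nat q) (chart_image c) (\<lambda>z vs. a * \<omega> c z vs + b * \<eta> c z vs)" if "c \<in> A" for c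
    using that assms by (intro local_form_linear atlas_facts(2)[OF assms(1)]) (auto simp: forms_def)
  then show ?thesis using assms(2,3) True by (simp add: forms_def zero_fun_def)
next
  case False
  then show ?thesis using assms(2,3) by (auto simp: forms_def zero_fun_def)
qed

lemma forms_smooth:
  assumes "complex_atlas X A" "\<omega> \<in> forms A p q" "c \<in> A"
  shows "smooth_on (chart_image c) (\<lambda>x. \<omega> c x ws)"
proof (cases "0 \<le> p \<and> 0 \<le> q")
  case True
  then show ?thesis
    using assms by (intro local_form_smooth[OF atlas_facts(2)[OF assms(1,3)]]) (auto simp: forms_def)
next
  case False
  then show ?thesis using assms by (auto simp: forms_def smooth_on_zero)
qed

lemma del_eq_Del:
  assumes "complex_atlas X A" "\<omega> \<in> forms A p q" "c \<in> A" "z \<in> chart_image c"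
  shows "del A \<omega> c z = Del (-\<i>) (\<omega> c) z" and "delbar A \<omega> c z = Del \<i> (\<omega> c) z"
proof -
  have d: "(\<lambda>x. \<omega> c x ws) differentiable at z" for ws
    by (rule smooth_on_differentiable[OF forms_smooth[OF assms(1-3)] assms(4)])
  show "del A \<omega> c z = Del (-\<i>) (\<omega> c) z" "delbar A \<omega> c z = Del \<i> (\<omega> c) z"
    using assms(3,4)
    by (auto simp: del_def delbar_def Del_def pd_eq_sum_wirtinger[OF d] alt_sum wedge1_eq_alt fun_eq_iff)
qed

lemma del_zero [simp]: "del A 0 = 0" and delbar_zero [simp]: "delbar A 0 = 0"
  by (auto simp: del_def delbar_def wirtinger_eq_pd wirtinger_bar_eq_pd wedge1_zero_right fun_eq_iff)

lemma del_delbar_in_forms: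
  assumes A: "complex_atlas X A" and \<omega>: "\<omega> \<in> forms A p q"
  shows "del A \<omega> \<in> forms A (p + 1) q" and "delbar A \<omega> \<in> forms A p (q + 1)"
proof -
  show "del A \<omega> \<in> forms A (p + 1) q"
  proof (cases "0 \<le> p \<and> 0 \<le> q")
    case True
    have lf: "local_form (nat p) (nat q) (chart_image c) (\<omega> c)" if "c \<in> A" for c
      using \<omega> True that by (simp add: forms_def)
    have "local_form (Suc (nat p)) (nat q) (chart_image c) (del A \<omega> c)" if c: "c \<in> A" for c
      by (rule local_form_Del(1)[OF atlas_facts(2)[OF A c] lf[OF c]]) (rule del_eq_Del[OF A \<omega> c])
    moreover have "del A \<omega> c z vs =
        del A \<omega> d (transition c d z) (map (frechet_derivative (transition c d) (at z)) vs)"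
      if c: "c \<in> A" and d: "d \<in> A" and z: "z \<in> overlap c d" for c d z vs
    proof -
      note tr = transition_in_chart_image[where d=d, OF atlas_facts(1)[OF A c]]
      have "Del (-\<i>) (\<omega> c) z vs =
          Del (-\<i>) (\<omega> d) (transition c d z) (map (frechet_derivative (transition c d) (at z)) vs)"
        by (rule Del_pullback[OF atlas_facts(3)[OF A c d] z atlas_facts(2)[OF A d] atlas_facts(4)[OF A c d] _ lf[OF d]])
          (use \<omega> True c d tr in \<open>auto simp: forms_def\<close>)
      then show ?thesis
        using del_eq_Del(1)[OF A \<omega> c] del_eq_Del(1)[OF A \<omega> d tr[OF z]] z overlap_subset by fastforce
    qed
    ultimately show ?thesis
      using True by (auto simp: forms_def nat_add_distrib del_def fun_eq_iff)
  next
    case False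
    then have "\<omega> = 0" using \<omega> by (auto simp: forms_def)
    then show ?thesis by (simp add: zero_in_forms)
  qed
  show "delbar A \<omega> \<in> forms A p (q + 1)"
  proof (cases "0 \<le> p \<and> 0 \<le> q")
    case True
    have lf: "local_form (nat p) (nat q) (chart_image c) (\<omega> c)" if "c \<in> A" for c
      using \<omega> True that by (simp add: forms_def)
    have "local_form (nat p) (Suc (nat q)) (chart_image c) (delbar A \<omega> c)" if c: "c \<in> A" for c
      by (rule local_form_Del(2)[OF atlas_facts(2)[OF A c] lf[OF c]]) (rule del_eq_Del[OF A \<omega> c])
    moreover have "delbar A \<omega> c z vs =
        delbar A \<omega> d (transition c d z) (map (frechet_derivative (transition c d) (at z)) vs)"
      if c: "c \<in> A" and d: "d \<in> A" and z: "z \<in> overlap c d" for c d z vs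
    proof -
      note tr = transition_in_chart_image[where d=d, OF atlas_facts(1)[OF A c]]
      have "Del \<i> (\<omega> c) z vs =
          Del \<i> (\<omega> d) (transition c d z) (map (frechet_derivative (transition c d) (at z)) vs)"
        by (rule Del_pullback[OF atlas_facts(3)[OF A c d] z atlas_facts(2)[OF A d] atlas_facts(4)[OF A c d] _ lf[OF d]])
          (use \<omega> True c d tr in \<open>auto simp: forms_def\<close>)
      then show ?thesis
        using del_eq_Del(2)[OF A \<omega> c] del_eq_Del(2)[OF A \<omega> d tr[OF z]] z overlap_subset by fastforce
    qed
    ultimately show ?thesis
      using True by (auto simp: forms_def nat_add_distrib delbar_def fun_eq_iff)
  next
    case False
    then have "\<omega> = 0" using \<omega> by (auto simp: forms_def)
    then show ?thesis by (simp add: zero_in_forms)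
  qed
qed

lemma Del_linear:
  assumes "\<And>ws. (\<lambda>x. \<omega> x ws) differentiable at z" "\<And>ws. (\<lambda>x. \<eta> x ws) differentiable at z"
  shows "Del s (\<lambda>x ws. a * \<omega> x ws + b * \<eta> x ws) z vs = a * Del s \<omega> z vs + b * Del s \<eta> z vs"
  by (simp add: Del_def pd_add pd_mult_left assms alt_linear)

lemma del_delbar_linear:
  assumes A: "complex_atlas X A" and \<omega>: "\<omega> \<in> forms A p q" and \<eta>: "\<eta> \<in> forms A p q"
  shows "del A (\<lambda>c z vs. a * \<omega> c z vs + b * \<eta> c z vs) = (\<lambda>c z vs. a * del A \<omega> c z vs + b * del A \<eta> c z vs)"
    and "delbar A (\<lambda>c z vs. a * \<omega> c z vs + b * \<eta> c z vs) = (\<lambda>c z vs. a * delbar A \<omega> c z vs + b * delbar A \<eta> c z vs)"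
proof -
  have d: "(\<lambda>x. \<omega> c x ws) differentiable at z" "(\<lambda>x. \<eta> c x ws) differentiable at z"
    if "c \<in> A" "z \<in> chart_image c" for c z ws
    using smooth_on_differentiable[OF forms_smooth[OF A _ that(1)] that(2)] \<omega> \<eta> by blast+
  note D = del_eq_Del[OF A forms_linear[OF A \<omega> \<eta>, of a b]] del_eq_Del[OF A \<omega>] del_eq_Del[OF A \<eta>]
  have "del A (\<lambda>c z vs. a * \<omega> c z vs + b * \<eta> c z vs) c z vs = a * del A \<omega> c z vs + b * del A \<eta> c z vs"
    "delbar A (\<lambda>c z vs. a * \<omega> c z vs + b * \<eta> c z vs) c z vs = a * delbar A \<omega> c z vs + b * delbar A \<eta> c z vs"
    if "c \<in> A" "z \<in> chart_image c" for c z vs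
    using that by (simp_all add: D Del_linear d)
  moreover have "del A \<theta> c z vs = 0" "delbar A \<theta> c z vs = 0" if "\<not> (c \<in> A \<and> z \<in> chart_image c)" for \<theta> c z vs
    using that by (auto simp: del_def delbar_def)
  ultimately show "del A (\<lambda>c z vs. a * \<omega> c z vs + b * \<eta> c z vs) = (\<lambda>c z vs. a * del A \<omega> c z vs + b * del A \<eta> c z vs)"
    "delbar A (\<lambda>c z vs. a * \<omega> c z vs + b * \<eta> c z vs) = (\<lambda>c z vs. a * delbar A \<omega> c z vs + b * delbar A \<eta> c z vs)"
    by (metis (no_types, lifting) add.right_neutral ext mult_zero_right)+
qed

lemma double_complex_relations:
  assumes A: "complex_atlas X A" and \<omega>: "\<omega> \<in> forms A p q"
  shows "del A (del A \<omega>) = 0" "delbar A (delbar A \<omega>) = 0" "del A (delbar A \<omega>) = - delbar A (del A \<omega>)"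
proof -
  note D = del_eq_Del[OF A \<omega>] del_eq_Del[OF A del_delbar_in_forms(1)[OF A \<omega>]]
    del_eq_Del[OF A del_delbar_in_forms(2)[OF A \<omega>]]
  have *: "del A (del A \<omega>) c z vs = - del A (del A \<omega>) c z vs"
    "delbar A (delbar A \<omega>) c z vs = - delbar A (delbar A \<omega>) c z vs"
    "del A (delbar A \<omega>) c z vs = - delbar A (del A \<omega>) c z vs" for c z vs
  proof (atomize (full), cases "c \<in> A \<and> z \<in> chart_image c")
    case True
    then have c: "c \<in> A" "z \<in> chart_image c" by auto
    note anti = Del_anticommute[OF atlas_facts(2)[OF A c(1)] c(2) forms_smooth[OF A \<omega> c(1)]]
    have "Del (-\<i>) (del A \<omega> c) z vs = - Del (-\<i>) (del A \<omega> c) z vs"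
      by (rule anti) (simp_all add: D c)
    moreover have "Del \<i> (delbar A \<omega> c) z vs = - Del \<i> (delbar A \<omega> c) z vs"
      by (rule anti) (simp_all add: D c)
    moreover have "Del (-\<i>) (delbar A \<omega> c) z vs = - Del \<i> (del A \<omega> c) z vs"
      by (rule anti) (simp_all add: D c)
    ultimately show "del A (del A \<omega>) c z vs = - del A (del A \<omega>) c z vs \<and>
      delbar A (delbar A \<omega>) c z vs = - delbar A (delbar A \<omega>) c z vs \<and>
      del A (delbar A \<omega>) c z vs = - delbar A (del A \<omega>) c z vs"
      by (simp add: D c)
  qed (auto simp: del_def delbar_def)
  then show "del A (del A \<omega>) = 0" "delbar A (delbar A \<omega>) = 0" "del A (delbar A \<omega>) = - delbar A (del A \<omega>)"
    by (auto simp: fun_eq_iff)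
qed

section \<open>Linear algebra with explicit carriers\<close>

locale vspace =
  fixes V :: "'v cvs"
  assumes zero_closed [simp]: "vzero V \<in> carr V"
    and add_closed [simp]: "x \<in> carr V \<Longrightarrow> y \<in> carr V \<Longrightarrow> vadd V x y \<in> carr V"
    and scale_closed [simp]: "x \<in> carr V \<Longrightarrow> vscale V a x \<in> carr V"
    and add_assoc: "x \<in> carr V \<Longrightarrow> y \<in> carr V \<Longrightarrow> z \<in> carr V \<Longrightarrow> vadd V (vadd V x y) z = vadd V x (vadd V y z)"
    and add_commute: "x \<in> carr V \<Longrightarrow> y \<in> carr V \<Longrightarrow> vadd V x y = vadd V y x"
    and add_zero [simp]: "x \<in> carr V \<Longrightarrow> vadd V x (vzero V) = x"
    and scale_add: "x \<in> carr V \<Longrightarrow> y \<in> carr V \<Longrightarrow> vscale V a (vadd V x y) = vadd V (vscale V a x) (vscale V a y)"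
    and add_scale: "x \<in> carr V \<Longrightarrow> vscale V (a + b) x = vadd V (vscale V a x) (vscale V b x)"
    and scale_scale: "x \<in> carr V \<Longrightarrow> vscale V a (vscale V b x) = vscale V (a * b) x"
    and scale_one [simp]: "x \<in> carr V \<Longrightarrow> vscale V 1 x = x"
    and scale_zero_left [simp]: "x \<in> carr V \<Longrightarrow> vscale V 0 x = vzero V"
begin

lemma zero_add [simp]: "x \<in> carr V \<Longrightarrow> vadd V (vzero V) x = x"
  using add_commute[of "vzero V" x] by simp

lemma add_left_commute:
  "x \<in> carr V \<Longrightarrow> y \<in> carr V \<Longrightarrow> z \<in> carr V \<Longrightarrow> vadd V x (vadd V y z) = vadd V y (vadd V x z)"
  using add_assoc add_commute by metis

lemmas add_ac = add_assoc add_commute add_left_commute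

abbreviation neg :: "'v \<Rightarrow> 'v" where "neg \<equiv> vscale V (-1)"

lemma add_neg [simp]: "x \<in> carr V \<Longrightarrow> vadd V x (neg x) = vzero V"
  using add_scale[of x 1 "-1"] by simp

lemma neg_add [simp]: "x \<in> carr V \<Longrightarrow> vadd V (neg x) x = vzero V"
  using add_commute add_neg by simp

lemma neg_add_cancel [simp]: "x \<in> carr V \<Longrightarrow> y \<in> carr V \<Longrightarrow> vadd V (neg x) (vadd V x y) = y"
  using add_assoc[of "neg x" x y] by simp

lemma add_neg_cancel [simp]: "x \<in> carr V \<Longrightarrow> y \<in> carr V \<Longrightarrow> vadd V x (vadd V (neg x) y) = y"
  using add_assoc[of x "neg x" y] by simp

lemma add_left_cancel: "x \<in> carr V \<Longrightarrow> y \<in> carr V \<Longrightarrow> z \<in> carr V \<Longrightarrow> vadd V x y = vadd V x z \<longleftrightarrow> y = z"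
  by (metis neg_add_cancel)

lemma diff_eq_zero: "x \<in> carr V \<Longrightarrow> y \<in> carr V \<Longrightarrow> vadd V x (neg y) = vzero V \<longleftrightarrow> x = y"
  by (metis add_commute add_neg add_left_cancel scale_closed)

lemma scale_zero_right [simp]: "vscale V a (vzero V) = vzero V"
  using scale_scale[of "vzero V" a 0] by simp

lemma subspaceD:
  assumes "vsubspace V W"
  shows "W \<subseteq> carr V" "x \<in> W \<Longrightarrow> x \<in> carr V" "vzero V \<in> W"
    "x \<in> W \<Longrightarrow> y \<in> W \<Longrightarrow> vadd V x y \<in> W" "x \<in> W \<Longrightarrow> vscale V a x \<in> W"
  using assms by (auto simp: vsubspace_def)

lemma restrict_vspace:
  assumes "vsubspace V W"
  shows "vspace (vrestrict V W)"
  by unfold_locales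
    (use subspaceD[OF assms] in \<open>auto simp: vrestrict_def add_assoc add_left_commute scale_add add_scale scale_scale
      intro: add_commute\<close>)

lemma subspace_carr: "vsubspace V (carr V)"
  by (auto simp: vsubspace_def)

end

lemma vrestrict_simps [simp]:
  "carr (vrestrict V W) = W" "vadd (vrestrict V W) = vadd V" "vzero (vrestrict V W) = vzero V"
  "vscale (vrestrict V W) = vscale V" "vrestrict (vrestrict V W) U = vrestrict V U"
  by (simp_all add: vrestrict_def)

lemma vdsum_simps [simp]:
  "carr (V \<oplus>\<^sub>v W) = carr V \<times> carr W" "vadd (V \<oplus>\<^sub>v W) (x, y) (x', y') = (vadd V x x', vadd W y y')"
  "vzero (V \<oplus>\<^sub>v W) = (vzero V, vzero W)" "vscale (V \<oplus>\<^sub>v W) a (x, y) = (vscale V a x, vscale W a y)"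
  by (simp_all add: vdsum_def)

lemma vsubspace_restrict: "vsubspace (vrestrict V W) U \<longleftrightarrow> vsubspace V U \<and> U \<subseteq> W" if "vsubspace V W"
  using that by (auto simp: vsubspace_def)

lemma vspace_dsum:
  assumes "vspace V" "vspace W"
  shows "vspace (V \<oplus>\<^sub>v W)"
proof -
  interpret V: vspace V by fact
  interpret W: vspace W by fact
  show ?thesis
    by unfold_locales (auto simp: V.add_assoc W.add_assoc V.scale_add W.scale_add V.add_scale W.add_scale
        V.scale_scale W.scale_scale intro: V.add_commute W.add_commute)
qed

definition vlinear :: "'v cvs \<Rightarrow> 'w cvs \<Rightarrow> ('v \<Rightarrow> 'w) \<Rightarrow> bool" where
  "vlinear V W f \<longleftrightarrow> f ` carr V \<subseteq> carr W \<and>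
     (\<forall>x\<in>carr V. \<forall>y\<in>carr V. f (vadd V x y) = vadd W (f x) (f y)) \<and>
     (\<forall>a. \<forall>x\<in>carr V. f (vscale V a x) = vscale W a (f x))"

lemma viso_iff_vlinear: "V \<cong>\<^sub>v W \<longleftrightarrow> (\<exists>f. vlinear V W f \<and> bij_betw f (carr V) (carr W))"
  unfolding viso_def vlinear_def bij_betw_def by blast

lemma vlinearD:
  assumes "vlinear V W f"
  shows "x \<in> carr V \<Longrightarrow> f x \<in> carr W"
    "x \<in> carr V \<Longrightarrow> y \<in> carr V \<Longrightarrow> f (vadd V x y) = vadd W (f x) (f y)"
    "x \<in> carr V \<Longrightarrow> f (vscale V a x) = vscale W a (f x)"
  using assms by (auto simp: vlinear_def)

lemma vlinear_zero:
  assumes "vlinear V W f" "vspace V" "vspace W"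
  shows "f (vzero V) = vzero W"
proof -
  interpret V: vspace V by fact
  interpret W: vspace W by fact
  show ?thesis
    using vlinearD(3)[OF assms(1) V.zero_closed, of 0] vlinearD(1)[OF assms(1) V.zero_closed] by simp
qed

lemma viso_sym:
  assumes "vspace V" "V \<cong>\<^sub>v W"
  shows "W \<cong>\<^sub>v V"
proof -
  interpret vspace V by fact
  obtain f where f: "vlinear V W f" "bij_betw f (carr V) (carr W)"
    using assms(2) by (auto simp: viso_iff_vlinear)
  let ?g = "inv_into (carr V) f"
  have g: "bij_betw ?g (carr W) (carr V)" by (rule bij_betw_inv_into[OF f(2)])
  have gf: "?g (f x) = x" if "x \<in> carr V" for x using f(2) that by (simp add: bij_betw_def)
  have fg: "f (?g y) = y" "?g y \<in> carr V" if "y \<in> carr W" for y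
    using f(2) g that by (auto simp: bij_betw_def f_inv_into_f)
  have "?g (vadd W x y) = vadd V (?g x) (?g y)" if "x \<in> carr W" "y \<in> carr W" for x y
    using gf[of "vadd V (?g x) (?g y)"] vlinearD(2)[OF f(1), of "?g x" "?g y"] fg that by simp
  moreover have "?g (vscale W a x) = vscale V a (?g x)" if "x \<in> carr W" for a x
    using gf[of "vscale V a (?g x)"] vlinearD(3)[OF f(1), of "?g x"] fg that by simp
  ultimately show ?thesis using g by (auto simp: viso_def)
qed

lemma viso_refl: "V \<cong>\<^sub>v V"
  unfolding viso_def by (intro exI[of _ id]) simp

lemma viso_trans [trans]:
  assumes "U \<cong>\<^sub>v V" "V \<cong>\<^sub>v W"
  shows "U \<cong>\<^sub>v W"
proof -
  obtain f g where f: "vlinear U V f" "bij_betw f (carr U) (carr V)"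
    and g: "vlinear V W g" "bij_betw g (carr V) (carr W)"
    using assms by (auto simp: viso_iff_vlinear)
  have "vlinear U W (g \<circ> f)"
    using f(1) g(1) by (auto simp: vlinear_def image_subset_iff)
  then show ?thesis using bij_betw_trans[OF f(2) g(2)] by (auto simp: viso_iff_vlinear)
qed

lemma viso_dsum:
  assumes "V \<cong>\<^sub>v V'" "W \<cong>\<^sub>v W'"
  shows "V \<oplus>\<^sub>v W \<cong>\<^sub>v V' \<oplus>\<^sub>v W'"
proof -
  obtain f g where f: "vlinear V V' f" "bij_betw f (carr V) (carr V')"
    and g: "vlinear W W' g" "bij_betw g (carr W) (carr W')"
    using assms by (auto simp: viso_iff_vlinear)
  have "vlinear (V \<oplus>\<^sub>v W) (V' \<oplus>\<^sub>v W') (map_prod f g)"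
    using f(1) g(1) by (auto simp: vlinear_def)
  then show ?thesis using bij_betw_map_prod[OF f(2) g(2)] by (auto simp: viso_iff_vlinear)
qed

lemma viso_dsum_assoc: "(U \<oplus>\<^sub>v V) \<oplus>\<^sub>v W \<cong>\<^sub>v U \<oplus>\<^sub>v (V \<oplus>\<^sub>v W)"
  unfolding viso_def
  by (intro exI[of _ "\<lambda>((x, y), z). (x, (y, z))"] conjI bij_betw_byWitness[where f'="\<lambda>(x, (y, z)). ((x, y), z)"])
    auto

lemma viso_complement:
  assumes "vspace V" "vsubspace V U" "complement_of V U W"
  shows "V \<cong>\<^sub>v vrestrict V U \<oplus>\<^sub>v vrestrict V W"
proof -
  interpret vspace V by fact
  have W: "vsubspace V W" and disj: "U \<inter> W = {vzero V}"
    and sum: "{vadd V u w |u w. u \<in> U \<and> w \<in> W} = carr V"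
    using assms(3) by (auto simp: complement_of_def)
  note U = subspaceD[OF assms(2)] and W' = subspaceD[OF W]
  let ?f = "\<lambda>(u, w). vadd V u w"
  have "inj_on ?f (U \<times> W)"
  proof (clarsimp simp: inj_on_def)
    fix u w u' w' assume *: "u \<in> U" "w \<in> W" "u' \<in> U" "w' \<in> W" "vadd V u w = vadd V u' w'"
    have "vadd V u (neg u') = vadd V w' (neg w)"
    proof -
      have "vadd V u (neg u') = vadd V (vadd V u (neg u')) (vadd V w (neg w))"
        using *(1-4) U(2) W'(2) by simp
      also have "\<dots> = vadd V (vadd V u w) (vadd V (neg u') (neg w))"
        using *(1-4) U(2) W'(2) by (simp add: add_ac del: add_neg add_neg_cancel neg_add neg_add_cancel)
      also have "\<dots> = vadd V (vadd V u' (neg u')) (vadd V w' (neg w))"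
        unfolding *(5) using *(1-4) U(2) W'(2) by (simp add: add_ac del: add_neg add_neg_cancel neg_add neg_add_cancel)
      also have "\<dots> = vadd V w' (neg w)"
        using *(1-4) U(2) W'(2) by simp
      finally show ?thesis .
    qed
    moreover have "vadd V u (neg u') \<in> U" "vadd V w' (neg w) \<in> W"
      using * U W' by auto
    ultimately have "vadd V u (neg u') = vzero V" "vadd V w' (neg w) = vzero V"
      using disj by auto
    then show "u = u' \<and> w = w'" using * U(2) W'(2) diff_eq_zero by metis
  qed
  moreover have "?f ` (U \<times> W) = carr V" unfolding sum[symmetric] by (rule equalityI; clarsimp simp: image_iff; blast)
  ultimately have "bij_betw ?f (carr (vrestrict V U \<oplus>\<^sub>v vrestrict V W)) (carr V)"
    by (simp add: bij_betw_def)
  moreover have "vlinear (vrestrict V U \<oplus>\<^sub>v vrestrict V W) V ?f"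
    using U(2) W'(2) by (auto simp: vlinear_def add_ac scale_add)
  ultimately have "vrestrict V U \<oplus>\<^sub>v vrestrict V W \<cong>\<^sub>v V" by (auto simp: viso_iff_vlinear)
  then show ?thesis
    by (rule viso_sym[rotated]) (intro vspace_dsum restrict_vspace assms W)
qed

lemma (in vspace) complement_exists:
  assumes U: "vsubspace V U"
  obtains W where "complement_of V U W"
proof -
  define F where "F = {W. vsubspace V W \<and> U \<inter> W = {vzero V}}"
  have "\<exists>M\<in>F. \<forall>X\<in>F. M \<subseteq> X \<longrightarrow> X = M"
  proof (rule subset_Zorn_nonempty)
    have "{vzero V} \<in> F" using subspaceD[OF U] by (auto simp: F_def vsubspace_def)
    then show "F \<noteq> {}" by blast
  next
    fix \<C> assume C: "\<C> \<noteq> {}" "subset.chain F \<C>"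
    have F: "vsubspace V W" "U \<inter> W = {vzero V}" if "W \<in> \<C>" for W
      using C(2) that by (auto simp: subset.chain_def F_def)
    have "vadd V x y \<in> \<Union>\<C>" if xy: "x \<in> \<Union>\<C>" "y \<in> \<Union>\<C>" for x y
    proof -
      obtain W W' where "W \<in> \<C>" "W' \<in> \<C>" "x \<in> W" "y \<in> W'" using xy by blast
      moreover have "W \<subseteq> W' \<or> W' \<subseteq> W" using C(2) calculation by (auto simp: subset.chain_def)
      ultimately show ?thesis using subspaceD(4)[OF F(1)] by blast
    qed
    moreover have "vscale V a x \<in> \<Union>\<C>" if "x \<in> \<Union>\<C>" for a x
      using subspaceD(5)[OF F(1)] that by blast
    moreover have "vzero V \<in> \<Union>\<C>"
      using subspaceD(3)[OF F(1)] C(1) by blast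
    moreover have "\<Union>\<C> \<subseteq> carr V"
      using subspaceD(1)[OF F(1)] by blast
    ultimately have "vsubspace V (\<Union>\<C>)"
      by (simp add: vsubspace_def)
    moreover have "U \<inter> \<Union>\<C> = (\<Union>W\<in>\<C>. U \<inter> W)" by blast
    then have "U \<inter> \<Union>\<C> = {vzero V}"
      using F(2) C(1) by simp
    ultimately show "\<Union>\<C> \<in> F"
      by (simp add: F_def)
  qed
  then obtain W where "W \<in> F" and maxF: "\<forall>X\<in>F. W \<subseteq> X \<longrightarrow> X = W" by blast
  then have W: "vsubspace V W" "U \<inter> W = {vzero V}" by (simp_all add: F_def)
  note U' = subspaceD[OF U] and W' = subspaceD[OF W(1)]
  have "x \<in> {vadd V u w |u w. u \<in> U \<and> w \<in> W}" if x: "x \<in> carr V" for x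
  proof (rule ccontr)
    assume no: "x \<notin> {vadd V u w |u w. u \<in> U \<and> w \<in> W}"
    define X where "X = {vadd V w (vscale V a x) |w a. w \<in> W}"
    have "vadd V y z \<in> X" if yz: "y \<in> X" "z \<in> X" for y z
    proof -
      obtain w a w' b where "y = vadd V w (vscale V a x)" "z = vadd V w' (vscale V b x)" "w \<in> W" "w' \<in> W"
        using yz unfolding X_def by blast
      then have "vadd V y z = vadd V (vadd V w w') (vscale V (a + b) x)" "vadd V w w' \<in> W"
        using x W'(2,4) by (simp_all add: add_scale add_ac)
      then show ?thesis by (auto simp: X_def)
    qed
    moreover have "vscale V b y \<in> X" if y: "y \<in> X" for b y
    proof -
      obtain w a where "y = vadd V w (vscale V a x)" "w \<in> W"
        using y unfolding X_def by blast
      then have "vscale V b y = vadd V (vscale V b w) (vscale V (b * a) x)" "vscale V b w \<in> W"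
        using x W'(2,5) by (simp_all add: scale_add scale_scale)
      then show ?thesis by (auto simp: X_def)
    qed
    moreover have "w \<in> X" if "w \<in> W" for w
      using that W'(2)[OF that] x unfolding X_def by (intro CollectI exI[of _ w] exI[of _ 0]) simp
    moreover have "X \<subseteq> carr V" using W'(2) x by (auto simp: X_def)
    ultimately have X: "vsubspace V X" "W \<subseteq> X" using W'(3) by (auto simp: vsubspace_def)
    have "y = vzero V" if y: "y \<in> U" "y \<in> X" for y
    proof -
      obtain w a where w: "y = vadd V w (vscale V a x)" "w \<in> W"
        using y(2) unfolding X_def by blast
      have "a = 0"
      proof (rule ccontr)
        assume "a \<noteq> 0"
        then have "x = vscale V (1 / a) (vscale V a x)" using x by (simp add: scale_scale)
        also have "vscale V a x = vadd V y (neg w)"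
          unfolding w(1) using W'(2)[OF w(2)] x
          by (subst add_commute[of w "vscale V a x"]) (simp_all add: add_assoc)
        also have "vscale V (1 / a) (vadd V y (neg w)) = vadd V (vscale V (1 / a) y) (vscale V (1 / a) (neg w))"
          using y(1) w(2) U'(2) W'(2) by (simp add: scale_add)
        finally have "x = vadd V (vscale V (1 / a) y) (vscale V (1 / a) (neg w))" .
        moreover have "vscale V (1 / a) y \<in> U" "vscale V (1 / a) (neg w) \<in> W"
          using y(1) w(2) by (simp_all only: U'(5) W'(5))
        ultimately show False using no by blast
      qed
      then have "y \<in> W" using w W'(2) x by simp
      then show ?thesis using y(1) W(2) by blast
    qed
    then have "U \<inter> X = {vzero V}" using U'(3) subspaceD(3)[OF X(1)] by blast
    then have "X = W" using maxF X by (simp add: F_def)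
    moreover have "x \<in> X" unfolding X_def
      using W'(3) x by (intro CollectI exI[of _ "vzero V"] exI[of _ 1]) simp
    ultimately have "x \<in> W" by simp
    then have "vadd V (vzero V) x \<in> {vadd V u w |u w. u \<in> U \<and> w \<in> W}" using U'(3) by blast
    then show False using no x by simp
  qed
  moreover have "{vadd V u w |u w. u \<in> U \<and> w \<in> W} \<subseteq> carr V" using U'(2) W'(2) by auto
  ultimately have "complement_of V U W" using W by (auto simp: complement_of_def)
  then show thesis by (rule that)
qed

definition vker :: "'v cvs \<Rightarrow> 'w cvs \<Rightarrow> ('v \<Rightarrow> 'w) \<Rightarrow> 'v set" where
  "vker V W f = {x \<in> carr V. f x = vzero W}"

lemma vsubspace_vker:
  assumes "vspace V" "vspace W" "vlinear V W f"
  shows "vsubspace V (vker V W f)"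
  using assms vlinear_zero[OF assms(3,1,2)] vlinearD[OF assms(3)]
  by (auto simp: vsubspace_def vker_def vspace.zero_closed vspace.add_closed vspace.scale_closed
      vspace.add_zero vspace.scale_zero_right)

lemma vsubspace_image:
  assumes "vspace V" "vspace W" "vlinear V W f" "vsubspace V U"
  shows "vsubspace W (f ` U)"
proof -
  interpret vspace V by fact
  note U = subspaceD[OF assms(4)] and f = vlinearD[OF assms(3)]
  have "vadd W (f x) (f y) \<in> f ` U" if "x \<in> U" "y \<in> U" for x y
    using f(2)[of x y, symmetric] that U by auto
  moreover have "vscale W a (f x) \<in> f ` U" if "x \<in> U" for a x
    using f(3)[of x a, symmetric] that U by auto
  moreover have "vzero W \<in> f ` U" using vlinear_zero[OF assms(3,1,2)] U(3) by force
  ultimately show ?thesis using U(2) f(1) by (auto simp: vsubspace_def)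
qed

lemma vker_eq_iff:
  assumes "vspace V" "vspace W" "vlinear V W f" "x \<in> carr V" "y \<in> carr V"
  shows "f x = f y \<longleftrightarrow> vadd V x (vscale V (-1) y) \<in> vker V W f"
proof -
  interpret V: vspace V by fact
  interpret W: vspace W by fact
  show ?thesis
    using assms(4,5) vlinearD[OF assms(3)] W.diff_eq_zero[of "f x" "f y"] by (simp add: vker_def)
qed

lemma viso_complement_vker:
  assumes "vspace V" "vspace W" "vlinear V W f" "f ` carr V = carr W" "complement_of V (vker V W f) C"
  shows "vrestrict V C \<cong>\<^sub>v W"
proof -
  interpret V: vspace V by fact
  interpret W: vspace W by fact
  have C: "vsubspace V C" and disj: "vker V W f \<inter> C = {vzero V}"
    and sum: "{vadd V u w |u w. u \<in> vker V W f \<and> w \<in> C} = carr V"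
    using assms(5) by (auto simp: complement_of_def)
  note C' = V.subspaceD[OF C] and f = vlinearD[OF assms(3)]
  have "inj_on f C"
  proof (rule inj_onI)
    fix x y assume *: "x \<in> C" "y \<in> C" "f x = f y"
    then have "vadd V x (V.neg y) \<in> vker V W f \<inter> C"
      using vker_eq_iff[OF assms(1-3)] C' by auto
    then show "x = y" using disj V.diff_eq_zero C' * by auto
  qed
  moreover have "f ` C = carr W"
  proof -
    have "f x \<in> f ` C" if x: "x \<in> carr V" for x
    proof -
      obtain u w where uw: "x = vadd V u w" "u \<in> vker V W f" "w \<in> C" using sum \<open>x \<in> carr V\<close> by blast
      then have "f x = f w" using f C' by (simp add: vker_def)
      then show ?thesis using uw by blast
    qed
    then show ?thesis using C'(2) unfolding assms(4)[symmetric] by blast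
  qed
  moreover have "vlinear (vrestrict V C) W f" using f C'(2) by (auto simp: vlinear_def)
  ultimately show ?thesis by (auto simp: viso_iff_vlinear bij_betw_def)
qed

context
  fixes V :: "'v cvs" and W
  assumes V: "vspace V" and W: "vsubspace V W"
begin

interpretation vspace V by (rule V)

lemma vcoset_eq_iff:
  assumes "x \<in> carr V" "y \<in> carr V"
  shows "vcoset V W x = vcoset V W y \<longleftrightarrow> vadd V x (neg y) \<in> W"
proof
  note W' = subspaceD[OF W]
  assume "vcoset V W x = vcoset V W y"
  moreover have "x \<in> vcoset V W x" using W'(3) assms by (force simp: vcoset_def)
  ultimately obtain w where "x = vadd V y w" "w \<in> W" by (auto simp: vcoset_def)
  then show "vadd V x (neg y) \<in> W" using assms W'(2) by (simp add: add_ac)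
next
  note W' = subspaceD[OF W]
  have sub: "vcoset V W x \<subseteq> vcoset V W y"
    if x: "x \<in> carr V" "y \<in> carr V" and d: "vadd V x (neg y) \<in> W" for x y
  proof
    fix z assume "z \<in> vcoset V W x"
    then obtain w where w: "z = vadd V x w" "w \<in> W" by (auto simp: vcoset_def)
    have "z = vadd V y (vadd V (vadd V x (neg y)) w)"
      using w W'(2) x by (simp add: add_ac)
    then show "z \<in> vcoset V W y" using w d W'(4) by (auto simp: vcoset_def)
  qed
  assume d: "vadd V x (neg y) \<in> W"
  have "vadd V y (neg x) = neg (vadd V x (neg y))"
    using assms by (simp add: scale_add scale_scale add_commute)
  then have "vadd V y (neg x) \<in> W" using d W'(5) by simp
  then show "vcoset V W x = vcoset V W y" using sub assms d by blast
qed

lemma vquot_simps: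
  shows "carr (vquot V W) = vcoset V W ` carr V"
    and "x \<in> carr V \<Longrightarrow> y \<in> carr V \<Longrightarrow> vadd (vquot V W) (vcoset V W x) (vcoset V W y) = vcoset V W (vadd V x y)"
    and "x \<in> carr V \<Longrightarrow> vscale (vquot V W) a (vcoset V W x) = vcoset V W (vscale V a x)"
    and "vzero (vquot V W) = vcoset V W (vzero V)"
proof -
  note W' = subspaceD[OF W]
  show "carr (vquot V W) = vcoset V W ` carr V" by (simp add: vquot_def)
  show "vzero (vquot V W) = vcoset V W (vzero V)" using W'(2) by (force simp: vquot_def vcoset_def)
  show "vadd (vquot V W) (vcoset V W x) (vcoset V W y) = vcoset V W (vadd V x y)"
    if xy: "x \<in> carr V" "y \<in> carr V"
  proof (rule set_eqI, rule iffI)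
    fix z assume "z \<in> vadd (vquot V W) (vcoset V W x) (vcoset V W y)"
    then obtain w w' where w: "z = vadd V (vadd V x w) (vadd V y w')" "w \<in> W" "w' \<in> W"
      by (auto simp: vquot_def vcoset_def)
    then have "z = vadd V (vadd V x y) (vadd V w w')" using xy W'(2) by (simp add: add_ac)
    then show "z \<in> vcoset V W (vadd V x y)" using w W'(4) by (auto simp: vcoset_def)
  next
    fix z assume "z \<in> vcoset V W (vadd V x y)"
    then obtain w where w: "z = vadd V (vadd V x y) w" "w \<in> W" by (auto simp: vcoset_def)
    then have "z = vadd V (vadd V x (vzero V)) (vadd V y w)" using xy W'(2) by (simp add: add_ac)
    then show "z \<in> vadd (vquot V W) (vcoset V W x) (vcoset V W y)"
      using w W'(3) unfolding vquot_def vcoset_def by (simp only: cvs.simps) blast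
  qed
  show "vscale (vquot V W) a (vcoset V W x) = vcoset V W (vscale V a x)" if x: "x \<in> carr V"
  proof (rule set_eqI, rule iffI)
    fix z assume "z \<in> vscale (vquot V W) a (vcoset V W x)"
    then obtain w w' where w: "z = vadd V (vscale V a (vadd V x w)) w'" "w \<in> W" "w' \<in> W"
      by (auto simp: vquot_def vcoset_def)
    then have "z = vadd V (vscale V a x) (vadd V (vscale V a w) w')"
      using x W'(2) by (simp add: scale_add add_ac)
    then show "z \<in> vcoset V W (vscale V a x)" using w W'(4,5) by (auto simp: vcoset_def)
  next
    fix z assume "z \<in> vcoset V W (vscale V a x)"
    then obtain w where w: "z = vadd V (vscale V a x) w" "w \<in> W" by (auto simp: vcoset_def)
    then have "z = vadd V (vscale V a (vadd V x (vzero V))) w" using x by simp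
    then show "z \<in> vscale (vquot V W) a (vcoset V W x)"
      using w W'(3) unfolding vquot_def vcoset_def by (simp only: cvs.simps) blast
  qed
qed

lemma vspace_quot: "vspace (vquot V W)"
  by unfold_locales
    (auto simp: vquot_simps add_ac scale_add add_scale scale_scale)

end

lemma viso_first:
  assumes V: "vspace V" and W: "vspace W" and f: "vlinear V W f"
  shows "vquot V (vker V W f) \<cong>\<^sub>v vrestrict W (f ` carr V)"
proof -
  interpret V: vspace V by fact
  interpret W: vspace W by fact
  let ?N = "vker V W f"
  have N: "vsubspace V ?N" by (rule vsubspace_vker[OF assms])
  note q = vquot_simps[OF V N] and f' = vlinearD[OF f]
  define g where "g C = the_elem (f ` C)" for C
  have g: "g (vcoset V ?N x) = f x" if x: "x \<in> carr V" for x
  proof -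
    have "f ` vcoset V ?N x = {f x}"
    proof -
      have "f (vadd V x w) = f x" if "w \<in> ?N" for w
        using that x f' by (simp add: vker_def)
      moreover have "x \<in> vcoset V ?N x"
        unfolding vcoset_def using x V.subspaceD(3)[OF N] by (intro CollectI exI[of _ "vzero V"]) simp
      ultimately show ?thesis unfolding vcoset_def by blast
    qed
    then show ?thesis by (simp add: g_def)
  qed
  have "inj_on g (vcoset V ?N ` carr V)"
    by (auto simp: inj_on_def g vcoset_eq_iff[OF V N] vker_eq_iff[OF V W f])
  moreover have "g ` vcoset V ?N ` carr V = f ` carr V" using g by (force simp: image_image)
  ultimately show ?thesis
    unfolding viso_def
    by (intro exI[of _ g]) (auto simp: q bij_betw_def g f')
qed

lemma complement_image:
  assumes V: "vspace V" and Y: "vspace Y" and f: "vlinear V Y f"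
    and U: "vsubspace V U" and c: "complement_of V U W" and k: "vker V Y f \<subseteq> U"
  shows "complement_of (vrestrict Y (f ` carr V)) (f ` U) (f ` W)"
proof -
  interpret V: vspace V by fact
  interpret Y: vspace Y by fact
  have W: "vsubspace V W" and disj: "U \<inter> W = {vzero V}"
    and sum: "{vadd V u w |u w. u \<in> U \<and> w \<in> W} = carr V"
    using c by (auto simp: complement_of_def)
  note U' = V.subspaceD[OF U] and W' = V.subspaceD[OF W] and f' = vlinearD[OF f]
  have f0: "f (vzero V) = vzero Y" by (rule vlinear_zero[OF f V Y])
  have "vsubspace (vrestrict Y (f ` carr V)) (f ` W)"
    using W'(1) vsubspace_image[OF V Y f W] vsubspace_image[OF V Y f V.subspace_carr]
    by (auto simp: vsubspace_restrict)
  moreover have *: "f u = vzero Y" if "u \<in> U" "w \<in> W" "f u = f w" for u w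
  proof -
    have "vadd V w (V.neg u) \<in> U"
      using that vker_eq_iff[OF V Y f, of w u] U' W' k by auto
    then have "vadd V (vadd V w (V.neg u)) u \<in> U" using U'(4) that by blast
    then have "w \<in> U" using U'(2) W'(2) that by (simp add: V.add_assoc)
    then have "w = vzero V" using disj that by blast
    then show ?thesis using f0 that by simp
  qed
  have "f ` U \<inter> f ` W \<subseteq> {vzero Y}" using * by blast
  moreover have "vzero Y \<in> f ` U" "vzero Y \<in> f ` W"
    unfolding f0[symmetric] using U'(3) W'(3) by blast+
  moreover have "{vadd Y u w |u w. u \<in> f ` U \<and> w \<in> f ` W} = f ` {vadd V u w |u w. u \<in> U \<and> w \<in> W}"
  proof (rule equalityI; clarsimp)
    show "vadd Y (f u) (f w) \<in> f ` {vadd V u w |u w. u \<in> U \<and> w \<in> W}" if "u \<in> U" "w \<in> W" for u w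
      using that U'(2) W'(2) by (subst f'(2)[symmetric]) auto
    show "\<exists>u' w'. f (vadd V u w) = vadd Y u' w' \<and> u' \<in> f ` U \<and> w' \<in> f ` W" if "u \<in> U" "w \<in> W" for u w
      using that U'(2) W'(2) by (subst f'(2)) auto
  qed
  ultimately show ?thesis unfolding complement_of_def sum vrestrict_simps by blast
qed

lemma image_modulo_kernel:
  assumes V: "vspace V" and Y: "vspace Y" and f: "vlinear V Y f" and cG: "vsubspace V cG"
    and c: "complement_of (vrestrict V cG) I G" and I: "I \<subseteq> vker V Y f"
  shows "f ` cG = f ` G"
proof -
  interpret V: vspace V by fact
  interpret Y: vspace Y by fact
  note f' = vlinearD[OF f]
  have G: "G \<subseteq> cG" and sum: "{vadd V u w |u w. u \<in> I \<and> w \<in> G} = cG"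
    using c by (auto simp: complement_of_def vsubspace_restrict[OF cG])
  have "f x \<in> f ` G" if x: "x \<in> cG" for x
  proof -
    obtain u w where uw: "x = vadd V u w" "u \<in> I" "w \<in> G" using sum x by blast
    moreover have "w \<in> carr V" using uw G V.subspaceD(1)[OF cG] by blast
    ultimately have "f x = f w" using f' I by (auto simp: vker_def)
    then show ?thesis using uw by blast
  qed
  then show ?thesis using G by blast
qed

lemma decompose_by_maps:
  assumes V: "vspace V" and V': "vspace V'" and Y: "vspace Y" and Q: "vspace Q"
    and f: "vlinear V Y f" and g: "vlinear V' Y g"
    and k: "vlinear Y Q k" "k ` carr Y = carr Q"
    and cG: "vsubspace V cG" "complement_of (vrestrict V cG) (vker V Y f) G" "complement_of V cG L"
    and cG': "vsubspace V' cG'" "complement_of V' cG' L'"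
    and sub: "vker V Y f \<subseteq> cG" and meet: "cG' = {x \<in> carr V'. g x \<in> f ` carr V}"
    and ker: "vker Y Q k = {vadd Y (f x) (g y) |x y. x \<in> carr V \<and> y \<in> carr V'}"
  shows "Y \<cong>\<^sub>v vrestrict Y (f ` G) \<oplus>\<^sub>v vrestrict Y (f ` L) \<oplus>\<^sub>v vrestrict Y (g ` L') \<oplus>\<^sub>v Q"
proof -
  interpret V: vspace V by fact
  interpret V': vspace V' by fact
  interpret Y: vspace Y by fact
  note f' = vlinearD[OF f] and g' = vlinearD[OF g]
  let ?N = "vker Y Q k" and ?F = "f ` carr V"
  have N: "vsubspace Y ?N" by (rule vsubspace_vker[OF Y Q k(1)])
  have F: "vsubspace Y ?F" by (rule vsubspace_image[OF V Y f V.subspace_carr])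
  have f0: "f (vzero V) = vzero Y" by (rule vlinear_zero[OF f V Y])
  have g0: "g (vzero V') = vzero Y" by (rule vlinear_zero[OF g V' Y])
  have FN: "?F \<subseteq> ?N"
  proof
    fix y assume "y \<in> ?F"
    then obtain x where "x \<in> carr V" "y = f x" by blast
    moreover from this have "y = vadd Y (f x) (g (vzero V'))" by (simp add: g0 f'(1))
    ultimately show "y \<in> ?N" unfolding ker using V'.zero_closed by blast
  qed
  have gN: "g ` carr V' \<subseteq> ?N"
  proof
    fix y assume "y \<in> g ` carr V'"
    then obtain x where "x \<in> carr V'" "y = g x" by blast
    moreover from this have "y = vadd Y (f (vzero V)) (g x)" by (simp add: f0 g'(1))
    ultimately show "y \<in> ?N" unfolding ker using V.zero_closed by blast
  qed
  obtain C where C: "complement_of Y ?N C" using Y.complement_exists[OF N] by blast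
  have L': "vsubspace V' L'" "cG' \<inter> L' = {vzero V'}" "{vadd V' u w |u w. u \<in> cG' \<and> w \<in> L'} = carr V'"
    using cG'(2) by (auto simp: complement_of_def)
  note L'' = V'.subspaceD[OF L'(1)] and cG'' = V'.subspaceD[OF cG'(1)] and F' = Y.subspaceD[OF F]
  have "complement_of (vrestrict Y ?N) ?F (g ` L')"
  proof -
    have sub: "vsubspace (vrestrict Y ?N) (g ` L')"
      using vsubspace_image[OF V' Y g L'(1)] gN L''(1) by (auto simp: vsubspace_restrict[OF N])
    have int: "?F \<inter> g ` L' = {vzero Y}"
    proof -
      have g_zero: "g w \<in> {vzero Y}" if w: "w \<in> L'" "g w \<in> ?F" for w
      proof -
        have "w \<in> cG' \<inter> L'" using w L''(2)[OF w(1)] unfolding meet by blast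
        then show ?thesis unfolding L'(2) by (simp add: g0)
      qed
      have "?F \<inter> g ` L' \<subseteq> {vzero Y}"
      proof
        fix y assume y: "y \<in> ?F \<inter> g ` L'"
        then obtain w where w: "w \<in> L'" "y = g w" by blast
        show "y \<in> {vzero Y}" using y g_zero[OF w(1)] unfolding w(2) by blast
      qed
      moreover have "vzero Y \<in> g ` L'" using imageI[OF L''(3), of g] by (simp only: g0)
      ultimately show ?thesis using F'(3) by blast
    qed
    have sum: "vadd Y (f x) (g y) \<in> {vadd Y u w |u w. u \<in> ?F \<and> w \<in> g ` L'}"
      if xy: "x \<in> carr V" "y \<in> carr V'" for x y
    proof -
      obtain u w where uw: "y = vadd V' u w" "u \<in> cG'" "w \<in> L'" using L'(3) xy by blast
      obtain z where z: "z \<in> carr V" "g u = f z" using uw(2) unfolding meet by blast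
      note cl = cG''(2)[OF uw(2)] L''(2)[OF uw(3)] z(1) xy(1)
      have "vadd Y (f x) (g y) = vadd Y (f x) (vadd Y (f z) (g w))"
        unfolding uw(1) z(2)[symmetric] using cl by (simp add: g'(2))
      also have "\<dots> = vadd Y (f (vadd V x z)) (g w)"
        using cl by (simp add: f'(1,2) g'(1) Y.add_assoc)
      finally show ?thesis using uw(3) V.add_closed[OF xy(1) z(1)] by blast
    qed
    have span: "{vadd Y u w |u w. u \<in> ?F \<and> w \<in> g ` L'} = ?N"
    proof
      show "{vadd Y u w |u w. u \<in> ?F \<and> w \<in> g ` L'} \<subseteq> ?N"
        unfolding ker using L''(1) by blast
      show "?N \<subseteq> {vadd Y u w |u w. u \<in> ?F \<and> w \<in> g ` L'}"
        unfolding ker using sum by blast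
    qed
    show ?thesis unfolding complement_of_def vrestrict_simps using sub int span by (intro conjI)
  qed
  then have "vrestrict Y ?N \<cong>\<^sub>v vrestrict Y ?F \<oplus>\<^sub>v vrestrict Y (g ` L')"
    using viso_complement[OF Y.restrict_vspace[OF N], of ?F] F FN by (simp add: vsubspace_restrict[OF N])
  moreover have "vrestrict Y ?F \<cong>\<^sub>v vrestrict Y (f ` G) \<oplus>\<^sub>v vrestrict Y (f ` L)"
  proof -
    have "vsubspace (vrestrict Y ?F) (f ` cG)"
      unfolding vsubspace_restrict[OF F]
      using vsubspace_image[OF V Y f cG(1)] V.subspaceD(1)[OF cG(1)] by blast
    from viso_complement[OF Y.restrict_vspace[OF F] this complement_image[OF V Y f cG(1,3) sub]]
    show ?thesis by (simp add: image_modulo_kernel[OF V Y f cG(1,2) order_refl])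
  qed
  ultimately have "vrestrict Y ?N \<cong>\<^sub>v (vrestrict Y (f ` G) \<oplus>\<^sub>v vrestrict Y (f ` L)) \<oplus>\<^sub>v vrestrict Y (g ` L')"
    by (rule viso_trans[OF _ viso_dsum[OF _ viso_refl]])
  moreover have "vrestrict Y C \<cong>\<^sub>v Q" by (rule viso_complement_vker[OF Y Q k C])
  ultimately have "Y \<cong>\<^sub>v ((vrestrict Y (f ` G) \<oplus>\<^sub>v vrestrict Y (f ` L)) \<oplus>\<^sub>v vrestrict Y (g ` L')) \<oplus>\<^sub>v Q"
    by (rule viso_trans[OF viso_complement[OF Y N C] viso_dsum])
  also have "\<dots> \<cong>\<^sub>v (vrestrict Y (f ` G) \<oplus>\<^sub>v vrestrict Y (f ` L)) \<oplus>\<^sub>v (vrestrict Y (g ` L') \<oplus>\<^sub>v Q)"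
    by (rule viso_dsum_assoc)
  also have "\<dots> \<cong>\<^sub>v vrestrict Y (f ` G) \<oplus>\<^sub>v vrestrict Y (f ` L) \<oplus>\<^sub>v vrestrict Y (g ` L') \<oplus>\<^sub>v Q"
    by (rule viso_dsum_assoc)
  finally show ?thesis .
qed

lemma decompose_by_filtration:
  assumes V: "vspace V" and X: "vspace X" and \<pi>: "vlinear X V \<pi>"
    and cG: "vsubspace V cG" "\<pi> ` carr X \<subseteq> cG"
    and c: "complement_of (vrestrict V cG) (\<pi> ` carr X) G" "complement_of V cG L"
  shows "V \<cong>\<^sub>v vquot X (vker X V \<pi>) \<oplus>\<^sub>v vrestrict V G \<oplus>\<^sub>v vrestrict V L"
proof -
  interpret V: vspace V by fact
  interpret X: vspace X by fact
  have im: "vsubspace V (\<pi> ` carr X)" by (rule vsubspace_image[OF X V \<pi> X.subspace_carr])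
  have 1: "vrestrict V (\<pi> ` carr X) \<cong>\<^sub>v vquot X (vker X V \<pi>)"
    by (rule viso_sym[OF vspace_quot[OF X vsubspace_vker[OF X V \<pi>]] viso_first[OF X V \<pi>]])
  have "vrestrict V cG \<cong>\<^sub>v vrestrict V (\<pi> ` carr X) \<oplus>\<^sub>v vrestrict V G"
    using viso_complement[OF V.restrict_vspace[OF cG(1)] _ c(1)] im cG(2)
    by (simp add: vsubspace_restrict[OF cG(1)])
  then have "vrestrict V cG \<cong>\<^sub>v vquot X (vker X V \<pi>) \<oplus>\<^sub>v vrestrict V G"
    by (rule viso_trans[OF _ viso_dsum[OF 1 viso_refl]])
  then have "V \<cong>\<^sub>v (vquot X (vker X V \<pi>) \<oplus>\<^sub>v vrestrict V G) \<oplus>\<^sub>v vrestrict V L"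
    by (rule viso_trans[OF viso_complement[OF V cG(1) c(2)] viso_dsum[OF _ viso_refl]])
  also have "\<dots> \<cong>\<^sub>v vquot X (vker X V \<pi>) \<oplus>\<^sub>v vrestrict V G \<oplus>\<^sub>v vrestrict V L"
    by (rule viso_dsum_assoc)
  finally show ?thesis .
qed

section \<open>Quotients of subspaces\<close>

definition coset :: "'f::ab_group_add set \<Rightarrow> 'f \<Rightarrow> 'f set" where
  "coset B x = {x + w |w. w \<in> B}"

definition coset_map :: "('f::ab_group_add \<Rightarrow> 'f) \<Rightarrow> 'f set \<Rightarrow> 'f set \<Rightarrow> 'f set" where
  "coset_map f B C = {f \<theta> + \<beta> |\<theta> \<beta>. \<theta> \<in> C \<and> \<beta> \<in> B}"

locale complex_space = vector_space sc for sc :: "complex \<Rightarrow> 'f::ab_group_add \<Rightarrow> 'f"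
begin

definition linear_map_on :: "'f set \<Rightarrow> ('f \<Rightarrow> 'f) \<Rightarrow> bool" where
  "linear_map_on S f \<longleftrightarrow> (\<forall>x\<in>S. \<forall>y\<in>S. f (x + y) = f x + f y) \<and> (\<forall>a. \<forall>x\<in>S. f (sc a x) = sc a (f x))"

lemma linear_map_onD:
  assumes "linear_map_on S f"
  shows "x \<in> S \<Longrightarrow> y \<in> S \<Longrightarrow> f (x + y) = f x + f y" "x \<in> S \<Longrightarrow> f (sc a x) = sc a (f x)"
  using assms by (auto simp: linear_map_on_def)

lemma linear_map_on_zero: "subspace S \<Longrightarrow> linear_map_on S f \<Longrightarrow> f 0 = 0"
  using linear_map_onD(2)[of S f 0 0] subspace_0[of S] by simp

lemma linear_map_on_diff:
  assumes "subspace S" "linear_map_on S f" "x \<in> S" "y \<in> S"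
  shows "f (x - y) = f x - f y"
  using linear_map_onD(1)[OF assms(2) subspace_diff[OF assms(1,3,4)] assms(4)] by simp

lemma linear_map_on_subset: "linear_map_on S f \<Longrightarrow> T \<subseteq> S \<Longrightarrow> linear_map_on T f"
  unfolding linear_map_on_def by blast

lemma linear_map_on_id: "linear_map_on S id"
  by (simp add: linear_map_on_def)

lemma subspace_image_on:
  assumes "subspace S" "linear_map_on S f"
  shows "subspace (f ` S)"
proof (rule subspaceI)
  show "0 \<in> f ` S" using linear_map_on_zero[OF assms] subspace_0[OF assms(1)] by force
  show "x + y \<in> f ` S" if xy: "x \<in> f ` S" "y \<in> f ` S" for x y
  proof -
    obtain a b where "a \<in> S" "b \<in> S" "x = f a" "y = f b" using xy by blast
    then have "x + y = f (a + b)" "a + b \<in> S"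
      using linear_map_onD(1)[OF assms(2)] subspace_add[OF assms(1)] by auto
    then show ?thesis by blast
  qed
  show "sc c x \<in> f ` S" if x: "x \<in> f ` S" for c x
  proof -
    obtain a where "a \<in> S" "x = f a" using x by blast
    then have "sc c x = f (sc c a)" "sc c a \<in> S"
      using linear_map_onD(2)[OF assms(2)] subspace_scale[OF assms(1)] by auto
    then show ?thesis by blast
  qed
qed

lemma subspace_vimage_on:
  assumes "subspace S" "linear_map_on S f" "subspace B"
  shows "subspace {x \<in> S. f x \<in> B}"
  by (rule subspaceI)
    (use assms linear_map_on_zero[OF assms(1,2)] linear_map_onD[OF assms(2)] in
      \<open>auto simp: subspace_0 subspace_add subspace_scale\<close>)

lemma subspace_kernel_on:
  assumes "subspace S" "linear_map_on S f"
  shows "subspace {x \<in> S. f x = 0}"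
  using subspace_vimage_on[OF assms subspace_single_0] by simp

definition space_on :: "'f set \<Rightarrow> 'f cvs" where
  "space_on S = \<lparr>carr = S, vadd = (+), vzero = 0, vscale = sc\<rparr>"

definition quot :: "'f set \<Rightarrow> 'f set \<Rightarrow> 'f set cvs" where
  "quot S B = vquot (space_on S) B"

lemma space_on_simps [simp]:
  "carr (space_on S) = S" "vadd (space_on S) = (+)" "vzero (space_on S) = 0" "vscale (space_on S) = sc"
  by (simp_all add: space_on_def)

lemma vspace_space_on: "subspace S \<Longrightarrow> vspace (space_on S)"
  by unfold_locales
    (auto simp: subspace_0 subspace_add subspace_scale scale_right_distrib scale_left_distrib add_ac)

lemma vsubspace_space_on: "subspace B \<Longrightarrow> B \<subseteq> S \<Longrightarrow> vsubspace (space_on S) B"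
  by (auto simp: vsubspace_def subspace_0 subspace_add subspace_scale)

lemma coset_eq_iff: "subspace B \<Longrightarrow> coset B x = coset B y \<longleftrightarrow> x - y \<in> B"
  using vcoset_eq_iff[OF vspace_space_on[OF subspace_UNIV] vsubspace_space_on, of B x y]
  by (simp add: coset_def vcoset_def)

lemma coset_eq_self_iff: "subspace B \<Longrightarrow> coset B x = B \<longleftrightarrow> x \<in> B"
  using coset_eq_iff[of B x 0] by (simp add: coset_def)

context
  fixes S B assumes S: "subspace S" and B: "subspace B" "B \<subseteq> S"
begin

lemma vspace_quotient: "vspace (quot S B)"
  unfolding quot_def by (rule vspace_quot[OF vspace_space_on[OF S] vsubspace_space_on[OF B]])

lemma quot_simps:
  shows "carr (quot S B) = coset B ` S" "vzero (quot S B) = B"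
    and "x \<in> S \<Longrightarrow> y \<in> S \<Longrightarrow> vadd (quot S B) (coset B x) (coset B y) = coset B (x + y)"
    and "x \<in> S \<Longrightarrow> vscale (quot S B) a (coset B x) = coset B (sc a x)"
proof -
  have "vcoset (space_on S) B = coset B" by (auto simp: vcoset_def coset_def fun_eq_iff)
  then show "carr (quot S B) = coset B ` S" "vzero (quot S B) = B"
    "x \<in> S \<Longrightarrow> y \<in> S \<Longrightarrow> vadd (quot S B) (coset B x) (coset B y) = coset B (x + y)"
    "x \<in> S \<Longrightarrow> vscale (quot S B) a (coset B x) = coset B (sc a x)"
    using vquot_simps[OF vspace_space_on[OF S] vsubspace_space_on[OF B]]
    by (simp_all add: quot_def) (simp add: vquot_def)
qed

context
  fixes S' B' f
  assumes S': "subspace S'" and B': "subspace B'" "B' \<subseteq> S'"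
    and f: "linear_map_on S f" "f ` S \<subseteq> S'" "f ` B \<subseteq> B'"
begin

lemma coset_map_coset:
  assumes "x \<in> S"
  shows "coset_map f B' (coset B x) = coset B' (f x)"
proof
  show "coset_map f B' (coset B x) \<subseteq> coset B' (f x)"
  proof
    fix y assume "y \<in> coset_map f B' (coset B x)"
    then obtain w b where y: "y = f (x + w) + b" "w \<in> B" "b \<in> B'"
      by (auto simp: coset_map_def coset_def)
    then have "y = f x + (f w + b)" "f w + b \<in> B'"
      using linear_map_onD(1)[OF f(1) assms] B(2) f(3) subspace_add[OF B'(1)] by (auto simp: add.assoc)
    then show "y \<in> coset B' (f x)" unfolding coset_def by blast
  qed
  show "coset B' (f x) \<subseteq> coset_map f B' (coset B x)"
    unfolding coset_def coset_map_def using subspace_0[OF B(1)] by force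
qed

lemma vlinear_coset_map: "vlinear (quot S B) (quot S' B') (coset_map f B')"
proof -
  have fS: "f x \<in> S'" if "x \<in> S" for x using f(2) that by blast
  show ?thesis
    unfolding vlinear_def
    by (auto simp: quot_simps coset_map_coset fS linear_map_onD[OF f(1)] subspace_add[OF S] subspace_scale[OF S]
        complex_space.quot_simps[OF complex_space_axioms S' B'] simp del: image_image)
qed

lemma vker_coset_map:
  "vker (quot S B) (quot S' B') (coset_map f B') = coset B ` {x \<in> S. f x \<in> B'}"
proof -
  have "coset_map f B' (coset B x) = vzero (quot S' B') \<longleftrightarrow> f x \<in> B'" if "x \<in> S" for x
    using that by (simp add: coset_map_coset coset_eq_self_iff[OF B'(1)]
      complex_space.quot_simps[OF complex_space_axioms S' B'])
  then show ?thesis by (auto simp: vker_def quot_simps)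
qed

end

end

end

section \<open>Cohomology of a double complex\<close>

locale double_complex = complex_space sc for sc :: "complex \<Rightarrow> 'f::ab_group_add \<Rightarrow> 'f" +
  fixes C :: "int \<Rightarrow> int \<Rightarrow> 'f set" and d d' :: "'f \<Rightarrow> 'f"
  assumes subspace_C: "subspace (C p q)"
    and linear_d: "linear_map_on (C p q) d" and linear_d': "linear_map_on (C p q) d'"
    and d_closed: "x \<in> C p q \<Longrightarrow> d x \<in> C (p + 1) q"
    and d'_closed: "x \<in> C p q \<Longrightarrow> d' x \<in> C p (q + 1)"
    and d_d: "x \<in> C p q \<Longrightarrow> d (d x) = 0" and d'_d': "x \<in> C p q \<Longrightarrow> d' (d' x) = 0"
    and d_d': "x \<in> C p q \<Longrightarrow> d (d' x) = - d' (d x)"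
begin

definition Zd :: "int \<Rightarrow> int \<Rightarrow> 'f set" where "Zd p q = {x \<in> C p q. d x = 0}"
definition Zd' :: "int \<Rightarrow> int \<Rightarrow> 'f set" where "Zd' p q = {x \<in> C p q. d' x = 0}"
definition ZA :: "int \<Rightarrow> int \<Rightarrow> 'f set" where "ZA p q = {x \<in> C p q. d (d' x) = 0}"
definition Bd :: "int \<Rightarrow> int \<Rightarrow> 'f set" where "Bd p q = d ` C (p - 1) q"
definition Bd' :: "int \<Rightarrow> int \<Rightarrow> 'f set" where "Bd' p q = d' ` C p (q - 1)"
definition Bdd' :: "int \<Rightarrow> int \<Rightarrow> 'f set" where "Bdd' p q = (\<lambda>x. d (d' x)) ` C (p - 1) (q - 1)"
definition BA :: "int \<Rightarrow> int \<Rightarrow> 'f set" where "BA p q = {x + y |x y. x \<in> Bd p q \<and> y \<in> Bd' p q}"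
definition BK :: "int \<Rightarrow> int \<Rightarrow> 'f set" where
  "BK p q = {x + y |x y. x \<in> Bd p q \<inter> Zd' p q \<and> y \<in> Bd' p q \<inter> Zd p q}"

definition HBC :: "int \<Rightarrow> int \<Rightarrow> 'f set cvs" where "HBC p q = quot (Zd p q \<inter> Zd' p q) (Bdd' p q)"
definition HA :: "int \<Rightarrow> int \<Rightarrow> 'f set cvs" where "HA p q = quot (ZA p q) (BA p q)"
definition HK :: "int \<Rightarrow> int \<Rightarrow> 'f set cvs" where "HK p q = quot (Zd p q \<inter> Zd' p q) (BK p q)"
definition Hd :: "int \<Rightarrow> int \<Rightarrow> 'f set cvs" where "Hd p q = quot (Zd p q) (Bd p q)"
definition Hd' :: "int \<Rightarrow> int \<Rightarrow> 'f set cvs" where "Hd' p q = quot (Zd' p q) (Bd' p q)"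

definition cGd :: "int \<Rightarrow> int \<Rightarrow> 'f set set" where
  "cGd p q = vker (HA p q) (Hd' (p + 1) q) (coset_map d (Bd' (p + 1) q))"
definition cGd' :: "int \<Rightarrow> int \<Rightarrow> 'f set set" where
  "cGd' p q = vker (HA p q) (Hd p (q + 1)) (coset_map d' (Bd p (q + 1)))"

lemmas lin_d = linear_map_onD[OF linear_d] and lin_d' = linear_map_onD[OF linear_d']

lemma d_pred: "x \<in> C (p - 1) q \<Longrightarrow> d x \<in> C p q"
  using d_closed[of x "p - 1" q] by simp

lemma d'_pred: "x \<in> C p (q - 1) \<Longrightarrow> d' x \<in> C p q"
  using d'_closed[of x p "q - 1"] by simp

lemma d'_d: "x \<in> C p q \<Longrightarrow> d' (d x) = - d (d' x)"
  using d_d' by simp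

lemma d_zero: "d 0 = 0" and d'_zero: "d' 0 = 0"
  using linear_map_on_zero[OF subspace_C linear_d] linear_map_on_zero[OF subspace_C linear_d'] by auto

lemma linear_d_d': "linear_map_on (C p q) (\<lambda>x. d (d' x))"
  using linear_d linear_d' d'_closed unfolding linear_map_on_def by metis

lemma subspaces:
  "subspace (Zd p q)" "subspace (Zd' p q)" "subspace (ZA p q)"
  "subspace (Bd p q)" "subspace (Bd' p q)" "subspace (Bdd' p q)" "subspace (BA p q)" "subspace (BK p q)"
  "subspace (Zd p q \<inter> Zd' p q)"
proof -
  show Z: "subspace (Zd p q)" "subspace (Zd' p q)" "subspace (ZA p q)"
    unfolding Zd_def Zd'_def ZA_def
    by (rule subspace_kernel_on[OF subspace_C] linear_d linear_d' linear_d_d')+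
  show B: "subspace (Bd p q)" "subspace (Bd' p q)" "subspace (Bdd' p q)"
    unfolding Bd_def Bd'_def Bdd'_def
    by (rule subspace_image_on[OF subspace_C] linear_d linear_d' linear_d_d')+
  show "subspace (BA p q)" "subspace (BK p q)" "subspace (Zd p q \<inter> Zd' p q)"
    unfolding BA_def BK_def by (intro subspace_sums subspace_inter Z B)+
qed

lemma ZA_iff: "x \<in> ZA p q \<longleftrightarrow> x \<in> C p q \<and> d' (d x) = 0"
  by (auto simp: ZA_def d_d')

lemma boundaries:
  "Bd p q \<subseteq> Zd p q" "Bd' p q \<subseteq> Zd' p q" "Bdd' p q \<subseteq> Bd p q" "Bdd' p q \<subseteq> Bd' p q"
  "Bd p q \<subseteq> ZA p q" "Bd' p q \<subseteq> ZA p q" "BA p q \<subseteq> ZA p q"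
proof -
  show 1: "Bd p q \<subseteq> Zd p q" "Bd' p q \<subseteq> Zd' p q"
    by (auto simp: Bd_def Bd'_def Zd_def Zd'_def d_pred d'_pred d_d d'_d')
  show "Bdd' p q \<subseteq> Bd p q"
    unfolding Bdd'_def Bd_def using d'_pred by blast
  show "Bdd' p q \<subseteq> Bd' p q"
  proof
    fix y assume "y \<in> Bdd' p q"
    then obtain x where x: "x \<in> C (p - 1) (q - 1)" "y = - d' (d x)"
      by (auto simp: Bdd'_def d_d')
    then show "y \<in> Bd' p q"
      using subspace_neg[OF subspaces(5)] d_pred unfolding Bd'_def by blast
  qed
  show 2: "Bd p q \<subseteq> ZA p q"
    using 1(1) by (auto simp: ZA_iff Zd_def d'_zero)
  show 3: "Bd' p q \<subseteq> ZA p q"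
    using 1(2) by (auto simp: ZA_def Zd'_def d_zero)
  show "BA p q \<subseteq> ZA p q"
    using 2 3 subspace_add[OF subspaces(3)] unfolding BA_def by blast
qed

lemma boundaries_closed:
  "Bdd' p q \<subseteq> Zd p q \<inter> Zd' p q" "BK p q \<subseteq> Zd p q \<inter> Zd' p q" "Bdd' p q \<subseteq> BK p q"
  "Bd p q \<subseteq> BA p q" "Bd' p q \<subseteq> BA p q"
proof -
  show 1: "Bdd' p q \<subseteq> Zd p q \<inter> Zd' p q" using boundaries by blast
  show "BK p q \<subseteq> Zd p q \<inter> Zd' p q"
    using boundaries(1,2)[of p q] subspace_add[OF subspaces(9)] unfolding BK_def by blast
  have "x + 0 \<in> BK p q" if "x \<in> Bdd' p q" for x
    using that boundaries(3)[of p q] 1 subspace_0[OF subspaces(1)] subspace_0[OF subspaces(5)]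
    unfolding BK_def by blast
  then show "Bdd' p q \<subseteq> BK p q" by auto
  have "x + 0 \<in> BA p q" if "x \<in> Bd p q" for x
    using that subspace_0[OF subspaces(5)] unfolding BA_def by blast
  then show "Bd p q \<subseteq> BA p q" by auto
  have "0 + x \<in> BA p q" if "x \<in> Bd' p q" for x
    using that subspace_0[OF subspaces(4)] unfolding BA_def by blast
  then show "Bd' p q \<subseteq> BA p q" by auto
qed

lemma C_of_cycles: "Zd p q \<subseteq> C p q" "Zd' p q \<subseteq> C p q" "ZA p q \<subseteq> C p q"
  by (auto simp: Zd_def Zd'_def ZA_def)

lemma Zd_subset_ZA: "Zd p q \<subseteq> ZA p q"
  by (auto simp: Zd_def ZA_iff d'_zero)

lemma d_ZA: "x \<in> ZA (p - 1) q \<Longrightarrow> d x \<in> Zd p q \<inter> Zd' p q"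
  using d_pred[of x p q] d_d[of x "p - 1" q] by (simp add: ZA_iff Zd_def Zd'_def)

lemma d'_ZA: "x \<in> ZA p (q - 1) \<Longrightarrow> d' x \<in> Zd p q \<inter> Zd' p q"
  using d'_pred[of x p q] d'_d'[of x p "q - 1"] by (simp add: ZA_def Zd_def Zd'_def)

lemma d_BA: "x \<in> BA (p - 1) q \<Longrightarrow> d x \<in> Bdd' p q"
proof -
  assume "x \<in> BA (p - 1) q"
  then obtain a b where x: "x = d a + d' b" "a \<in> C (p - 1 - 1) q" "b \<in> C (p - 1) (q - 1)"
    unfolding BA_def Bd_def Bd'_def by blast
  have "d x = d (d' b)"
    unfolding x(1) lin_d(1)[OF d_pred[OF x(2)] d'_pred[OF x(3)]] d_d[OF x(2)] by simp
  then show ?thesis using x(3) by (simp add: Bdd'_def)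
qed

lemma d'_BA: "x \<in> BA p (q - 1) \<Longrightarrow> d' x \<in> Bdd' p q"
proof -
  assume "x \<in> BA p (q - 1)"
  then obtain a b where x: "x = d a + d' b" "a \<in> C (p - 1) (q - 1)" "b \<in> C p (q - 1 - 1)"
    unfolding BA_def Bd_def Bd'_def by blast
  have "d' x = - d (d' a)"
    unfolding x(1) lin_d'(1)[OF d_pred[OF x(2)] d'_pred[OF x(3)]] d'_d'[OF x(3)] d'_d[OF x(2)] by simp
  moreover have "d (d' a) \<in> Bdd' p q" using x(2) by (simp add: Bdd'_def)
  ultimately show ?thesis using subspace_neg[OF subspaces(6)] by simp
qed

lemma cohomology_vspace: "vspace (HBC p q)" "vspace (HA p q)" "vspace (HK p q)" "vspace (Hd p q)" "vspace (Hd' p q)"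
  unfolding HBC_def HA_def HK_def Hd_def Hd'_def
  by (intro vspace_quotient subspaces boundaries boundaries_closed)+

lemma carr_HA: "carr (HA p q) = coset (BA p q) ` ZA p q"
  unfolding HA_def by (intro quot_simps(1) subspaces boundaries)

lemma del_A_BC_maps:
  shows "x \<in> ZA (p - 1) q \<Longrightarrow> coset_map d (Bdd' p q) (coset (BA (p - 1) q) x) = coset (Bdd' p q) (d x)"
    and "vlinear (HA (p - 1) q) (HBC p q) (coset_map d (Bdd' p q))"
    and "vker (HA (p - 1) q) (HBC p q) (coset_map d (Bdd' p q)) = coset (BA (p - 1) q) ` {x \<in> ZA (p - 1) q. d x \<in> Bdd' p q}"
proof -
  note * = subspaces(3) subspaces(7) boundaries(7) subspaces(9) subspaces(6) boundaries_closed(1)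
    linear_map_on_subset[OF linear_d C_of_cycles(3)] image_subsetI[OF d_ZA] image_subsetI[OF d_BA]
  show "x \<in> ZA (p - 1) q \<Longrightarrow> coset_map d (Bdd' p q) (coset (BA (p - 1) q) x) = coset (Bdd' p q) (d x)"
    by (rule coset_map_coset[OF *])
  show "vlinear (HA (p - 1) q) (HBC p q) (coset_map d (Bdd' p q))"
    unfolding HA_def HBC_def by (rule vlinear_coset_map[OF *])
  show "vker (HA (p - 1) q) (HBC p q) (coset_map d (Bdd' p q)) = coset (BA (p - 1) q) ` {x \<in> ZA (p - 1) q. d x \<in> Bdd' p q}"
    unfolding HA_def HBC_def by (rule vker_coset_map[OF *])
qed

lemma delbar_A_BC_maps:
  shows "x \<in> ZA p (q - 1) \<Longrightarrow> coset_map d' (Bdd' p q) (coset (BA p (q - 1)) x) = coset (Bdd' p q) (d' x)"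
    and "vlinear (HA p (q - 1)) (HBC p q) (coset_map d' (Bdd' p q))"
proof -
  note * = subspaces(3) subspaces(7) boundaries(7) subspaces(9) subspaces(6) boundaries_closed(1)
    linear_map_on_subset[OF linear_d' C_of_cycles(3)] image_subsetI[OF d'_ZA] image_subsetI[OF d'_BA]
  show "x \<in> ZA p (q - 1) \<Longrightarrow> coset_map d' (Bdd' p q) (coset (BA p (q - 1)) x) = coset (Bdd' p q) (d' x)"
    by (rule coset_map_coset[OF *])
  show "vlinear (HA p (q - 1)) (HBC p q) (coset_map d' (Bdd' p q))"
    unfolding HA_def HBC_def by (rule vlinear_coset_map[OF *])
qed

lemma BC_K_maps:
  shows "x \<in> Zd p q \<inter> Zd' p q \<Longrightarrow> coset_map id (BK p q) (coset (Bdd' p q) x) = coset (BK p q) x"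
    and "vlinear (HBC p q) (HK p q) (coset_map id (BK p q))"
    and "vker (HBC p q) (HK p q) (coset_map id (BK p q)) = coset (Bdd' p q) ` BK p q"
proof -
  have "id ` (Zd p q \<inter> Zd' p q) \<subseteq> Zd p q \<inter> Zd' p q" "id ` Bdd' p q \<subseteq> BK p q"
    using boundaries_closed by auto
  note * = subspaces(9) subspaces(6) boundaries_closed(1) subspaces(9) subspaces(8) boundaries_closed(2)
    linear_map_on_id this
  show "x \<in> Zd p q \<inter> Zd' p q \<Longrightarrow> coset_map id (BK p q) (coset (Bdd' p q) x) = coset (BK p q) x"
    using coset_map_coset[OF *] by simp
  show "vlinear (HBC p q) (HK p q) (coset_map id (BK p q))"
    unfolding HBC_def HK_def by (rule vlinear_coset_map[OF *])
  have "{x \<in> Zd p q \<inter> Zd' p q. id x \<in> BK p q} = BK p q" using boundaries_closed(2) by auto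
  then show "vker (HBC p q) (HK p q) (coset_map id (BK p q)) = coset (Bdd' p q) ` BK p q"
    unfolding HBC_def HK_def by (subst vker_coset_map[OF *]) simp
qed

lemma pi_A_maps:
  shows "x \<in> Zd p q \<Longrightarrow> coset_map id (BA p q) (coset (Bd p q) x) = coset (BA p q) x"
    and "vlinear (Hd p q) (HA p q) (coset_map id (BA p q))"
    and "vker (Hd p q) (HA p q) (coset_map id (BA p q)) = coset (Bd p q) ` (Zd p q \<inter> BA p q)"
proof -
  have "id ` Zd p q \<subseteq> ZA p q" "id ` Bd p q \<subseteq> BA p q"
    using Zd_subset_ZA boundaries_closed by auto
  note * = subspaces(1) subspaces(4) boundaries(1) subspaces(3) subspaces(7) boundaries(7)
    linear_map_on_id this
  show "x \<in> Zd p q \<Longrightarrow> coset_map id (BA p q) (coset (Bd p q) x) = coset (BA p q) x"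
    using coset_map_coset[OF *] by simp
  show "vlinear (Hd p q) (HA p q) (coset_map id (BA p q))"
    unfolding Hd_def HA_def by (rule vlinear_coset_map[OF *])
  have "{x \<in> Zd p q. id x \<in> BA p q} = Zd p q \<inter> BA p q" by auto
  then show "vker (Hd p q) (HA p q) (coset_map id (BA p q)) = coset (Bd p q) ` (Zd p q \<inter> BA p q)"
    unfolding Hd_def HA_def by (subst vker_coset_map[OF *]) simp
qed

lemma del_A_delbar_maps:
  shows "vlinear (HA (p - 1) q) (Hd' p q) (coset_map d (Bd' p q))"
    and "vker (HA (p - 1) q) (Hd' p q) (coset_map d (Bd' p q)) = coset (BA (p - 1) q) ` {x \<in> ZA (p - 1) q. d x \<in> Bd' p q}"
proof -
  have "d ` ZA (p - 1) q \<subseteq> Zd' p q" "d ` BA (p - 1) q \<subseteq> Bd' p q"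
    using d_ZA d_BA boundaries(4) by blast+
  note * = subspaces(3) subspaces(7) boundaries(7) subspaces(2) subspaces(5) boundaries(2)
    linear_map_on_subset[OF linear_d C_of_cycles(3)] this
  show "vlinear (HA (p - 1) q) (Hd' p q) (coset_map d (Bd' p q))"
    unfolding HA_def Hd'_def by (rule vlinear_coset_map[OF *])
  show "vker (HA (p - 1) q) (Hd' p q) (coset_map d (Bd' p q)) = coset (BA (p - 1) q) ` {x \<in> ZA (p - 1) q. d x \<in> Bd' p q}"
    unfolding HA_def Hd'_def by (rule vker_coset_map[OF *])
qed

lemma delbar_A_del_maps:
  shows "x \<in> ZA p (q - 1) \<Longrightarrow> coset_map d' (Bd p q) (coset (BA p (q - 1)) x) = coset (Bd p q) (d' x)"
    and "vlinear (HA p (q - 1)) (Hd p q) (coset_map d' (Bd p q))"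
    and "vker (HA p (q - 1)) (Hd p q) (coset_map d' (Bd p q)) = coset (BA p (q - 1)) ` {x \<in> ZA p (q - 1). d' x \<in> Bd p q}"
proof -
  have "d' ` ZA p (q - 1) \<subseteq> Zd p q" "d' ` BA p (q - 1) \<subseteq> Bd p q"
    using d'_ZA d'_BA boundaries(3) by blast+
  note * = subspaces(3) subspaces(7) boundaries(7) subspaces(1) subspaces(4) boundaries(1)
    linear_map_on_subset[OF linear_d' C_of_cycles(3)] this
  show "x \<in> ZA p (q - 1) \<Longrightarrow> coset_map d' (Bd p q) (coset (BA p (q - 1)) x) = coset (Bd p q) (d' x)"
    by (rule coset_map_coset[OF *])
  show "vlinear (HA p (q - 1)) (Hd p q) (coset_map d' (Bd p q))"
    unfolding HA_def Hd_def by (rule vlinear_coset_map[OF *])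
  show "vker (HA p (q - 1)) (Hd p q) (coset_map d' (Bd p q)) = coset (BA p (q - 1)) ` {x \<in> ZA p (q - 1). d' x \<in> Bd p q}"
    unfolding HA_def Hd_def by (rule vker_coset_map[OF *])
qed

lemma cGd_subspace: "vsubspace (HA p q) (cGd p q)"
  unfolding cGd_def
  using vsubspace_vker[OF cohomology_vspace(2,5) del_A_delbar_maps(1)[of "p + 1" q]] by simp

lemma cGd'_subspace: "vsubspace (HA p q) (cGd' p q)"
  unfolding cGd'_def
  using vsubspace_vker[OF cohomology_vspace(2,4) delbar_A_del_maps(2)[of p "q + 1"]] by simp

lemma cGd_eq: "cGd (p - 1) q = coset (BA (p - 1) q) ` {x \<in> ZA (p - 1) q. d x \<in> Bd' p q}"
  unfolding cGd_def using del_A_delbar_maps(2) by simp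

lemma cGd'_eq: "cGd' p (q - 1) = coset (BA p (q - 1)) ` {x \<in> ZA p (q - 1). d' x \<in> Bd p q}"
  unfolding cGd'_def using delbar_A_del_maps(3) by simp

lemma vker_del_A_BC:
  "vker (HA (p - 1) q) (HBC p q) (coset_map d (Bdd' p q)) = coset_map id (BA (p - 1) q) ` carr (Hd (p - 1) q)"
proof -
  have "coset_map id (BA (p - 1) q) ` carr (Hd (p - 1) q) = coset (BA (p - 1) q) ` Zd (p - 1) q"
    using pi_A_maps(1) by (simp add: Hd_def quot_simps(1) subspaces boundaries image_image)
  also have "\<dots> = coset (BA (p - 1) q) ` {x \<in> ZA (p - 1) q. d x \<in> Bdd' p q}"
  proof (rule equalityI; rule image_subsetI)
    fix x assume "x \<in> Zd (p - 1) q"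
    then have "x \<in> ZA (p - 1) q" "d x \<in> Bdd' p q"
      using Zd_subset_ZA subspace_0[OF subspaces(6)] by (auto simp: Zd_def)
    then show "coset (BA (p - 1) q) x \<in> coset (BA (p - 1) q) ` {x \<in> ZA (p - 1) q. d x \<in> Bdd' p q}" by blast
  next
    fix x assume "x \<in> {x \<in> ZA (p - 1) q. d x \<in> Bdd' p q}"
    then obtain b where x: "x \<in> C (p - 1) q" and b: "b \<in> C (p - 1) (q - 1)" "d x = d (d' b)"
      by (auto simp: Bdd'_def ZA_def)
    have b': "d' b \<in> C (p - 1) q" "d' b \<in> BA (p - 1) q"
      using d'_pred[OF b(1)] boundaries_closed(5)[of "p - 1" q] b(1) unfolding Bd'_def by blast+
    have "x - d' b \<in> Zd (p - 1) q"
      using x b b' linear_map_on_diff[OF subspace_C linear_d x b'(1)] subspace_diff[OF subspace_C x b'(1)]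
      by (simp add: Zd_def)
    moreover have "coset (BA (p - 1) q) x = coset (BA (p - 1) q) (x - d' b)"
      using b' by (simp add: coset_eq_iff subspaces)
    ultimately show "coset (BA (p - 1) q) x \<in> coset (BA (p - 1) q) ` Zd (p - 1) q" by blast
  qed
  finally show ?thesis by (simp add: del_A_BC_maps(3))
qed

theorem HBC_decomposition:
  assumes G: "complement_of (vrestrict (HA (p - 1) q) (cGd (p - 1) q)) (coset_map id (BA (p - 1) q) ` carr (Hd (p - 1) q)) G"
    and L: "complement_of (HA (p - 1) q) (cGd (p - 1) q) L"
    and L': "complement_of (HA p (q - 1)) (cGd' p (q - 1)) L'"
  shows "HBC p q \<cong>\<^sub>v vrestrict (HBC p q) (coset_map d (Bdd' p q) ` G)
    \<oplus>\<^sub>v vrestrict (HBC p q) (coset_map d (Bdd' p q) ` L)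
    \<oplus>\<^sub>v vrestrict (HBC p q) (coset_map d' (Bdd' p q) ` L') \<oplus>\<^sub>v HK p q"
proof (rule decompose_by_maps[OF cohomology_vspace(2,2,1,3) del_A_BC_maps(2) delbar_A_BC_maps(2) BC_K_maps(2)
      _ cGd_subspace _ L cGd'_subspace L'])
  let ?B = "Bdd' p q"
  have carr_HBC: "carr (HBC p q) = coset ?B ` (Zd p q \<inter> Zd' p q)"
    unfolding HBC_def by (intro quot_simps(1) subspaces boundaries_closed)
  have add_HBC: "vadd (HBC p q) (coset ?B x) (coset ?B y) = coset ?B (x + y)"
    if "x \<in> Zd p q \<inter> Zd' p q" "y \<in> Zd p q \<inter> Zd' p q" for x y
    unfolding HBC_def using that by (intro quot_simps(3) subspaces boundaries_closed)
  have f_image: "coset_map d ?B ` carr (HA (p - 1) q) = (\<lambda>x. coset ?B (d x)) ` ZA (p - 1) q"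
    unfolding carr_HA image_image using del_A_BC_maps(1) by (intro image_cong) auto
  have carr_HK: "carr (HK p q) = coset (BK p q) ` (Zd p q \<inter> Zd' p q)"
    unfolding HK_def by (intro quot_simps(1) subspaces boundaries_closed)
  show "coset_map id (BK p q) ` carr (HBC p q) = carr (HK p q)"
    unfolding carr_HBC carr_HK image_image using BC_K_maps(1) by (intro image_cong) auto
  show "complement_of (vrestrict (HA (p - 1) q) (cGd (p - 1) q)) (vker (HA (p - 1) q) (HBC p q) (coset_map d ?B)) G"
    unfolding vker_del_A_BC by (rule G)
  show "vker (HA (p - 1) q) (HBC p q) (coset_map d ?B) \<subseteq> cGd (p - 1) q"
    unfolding del_A_BC_maps(3) cGd_eq using boundaries(4) by blast
  show "cGd' p (q - 1) = {h \<in> carr (HA p (q - 1)). coset_map d' ?B h \<in> coset_map d ?B ` carr (HA (p - 1) q)}"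
  proof -
    have key: "coset ?B (d' x) \<in> (\<lambda>x. coset ?B (d x)) ` ZA (p - 1) q \<longleftrightarrow> d' x \<in> Bd p q" if x: "x \<in> ZA p (q - 1)" for x
    proof
      assume "coset ?B (d' x) \<in> (\<lambda>x. coset ?B (d x)) ` ZA (p - 1) q"
      then obtain y where y: "y \<in> ZA (p - 1) q" "d' x - d y \<in> ?B"
        by (auto simp: coset_eq_iff subspaces)
      have "d y \<in> Bd p q" using y(1) by (auto simp: Bd_def ZA_def)
      moreover have "d' x - d y \<in> Bd p q" using y(2) boundaries(3) by blast
      ultimately show "d' x \<in> Bd p q" using subspace_add[OF subspaces(4)] by fastforce
    next
      assume "d' x \<in> Bd p q"
      then obtain y where y: "y \<in> C (p - 1) q" "d' x = d y" by (auto simp: Bd_def)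
      have "d' (d y) = 0" using x d'_d' by (auto simp: y(2)[symmetric] ZA_def)
      then have "y \<in> ZA (p - 1) q" using y(1) by (simp add: ZA_iff)
      then show "coset ?B (d' x) \<in> (\<lambda>x. coset ?B (d x)) ` ZA (p - 1) q" using y(2) by auto
    qed
    have "coset_map d' ?B (coset (BA p (q - 1)) x) \<in> (\<lambda>x. coset ?B (d x)) ` ZA (p - 1) q \<longleftrightarrow> d' x \<in> Bd p q"
      if "x \<in> ZA p (q - 1)" for x
      by (simp only: delbar_A_BC_maps(1)[OF that] key[OF that])
    then show ?thesis
      unfolding f_image cGd'_eq carr_HA[of p "q - 1"] by blast
  qed
  show "vker (HBC p q) (HK p q) (coset_map id (BK p q)) = {vadd (HBC p q) (coset_map d ?B x) (coset_map d' ?B y) |x y.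
      x \<in> carr (HA (p - 1) q) \<and> y \<in> carr (HA p (q - 1))}"
  proof -
    have "{vadd (HBC p q) (coset_map d ?B x) (coset_map d' ?B y) |x y.
        x \<in> carr (HA (p - 1) q) \<and> y \<in> carr (HA p (q - 1))} = {coset ?B (d x + d' y) |x y. x \<in> ZA (p - 1) q \<and> y \<in> ZA p (q - 1)}"
      (is "?L = ?R")
    proof -
      have *: "vadd (HBC p q) (coset_map d ?B (coset (BA (p - 1) q) x)) (coset_map d' ?B (coset (BA p (q - 1)) y)) = coset ?B (d x + d' y)"
        if "x \<in> ZA (p - 1) q" "y \<in> ZA p (q - 1)" for x y
        using that by (simp only: del_A_BC_maps(1) delbar_A_BC_maps(1) add_HBC d_ZA d'_ZA)
      show ?thesis unfolding carr_HA
      proof (intro equalityI subsetI)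
        fix z assume "z \<in> {vadd (HBC p q) (coset_map d ?B x) (coset_map d' ?B y) |x y.
          x \<in> coset (BA (p - 1) q) ` ZA (p - 1) q \<and> y \<in> coset (BA p (q - 1)) ` ZA p (q - 1)}"
        then obtain x y where "x \<in> ZA (p - 1) q" "y \<in> ZA p (q - 1)"
          "z = vadd (HBC p q) (coset_map d ?B (coset (BA (p - 1) q) x)) (coset_map d' ?B (coset (BA p (q - 1)) y))"
          by blast
        then show "z \<in> ?R" using * by blast
      next
        fix z assume "z \<in> ?R"
        then obtain x y where xy: "x \<in> ZA (p - 1) q" "y \<in> ZA p (q - 1)" "z = coset ?B (d x + d' y)" by blast
        then show "z \<in> {vadd (HBC p q) (coset_map d ?B x) (coset_map d' ?B y) |x y.
          x \<in> coset (BA (p - 1) q) ` ZA (p - 1) q \<and> y \<in> coset (BA p (q - 1)) ` ZA p (q - 1)}"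
          using *[OF xy(1,2), symmetric] by blast
      qed
    qed
    moreover have "BK p q = {d x + d' y |x y. x \<in> ZA (p - 1) q \<and> y \<in> ZA p (q - 1)}"
    proof (intro equalityI subsetI)
      fix z assume "z \<in> BK p q"
      then obtain x y where "z = d x + d' y" "x \<in> C (p - 1) q" "d' (d x) = 0" "y \<in> C p (q - 1)" "d (d' y) = 0"
        by (auto simp: BK_def Bd_def Bd'_def Zd_def Zd'_def)
      then show "z \<in> {d x + d' y |x y. x \<in> ZA (p - 1) q \<and> y \<in> ZA p (q - 1)}"
        using ZA_iff[of x "p - 1" q] by (auto simp: ZA_def)
    next
      fix z assume "z \<in> {d x + d' y |x y. x \<in> ZA (p - 1) q \<and> y \<in> ZA p (q - 1)}"
      then obtain x y where xy: "z = d x + d' y" "x \<in> ZA (p - 1) q" "y \<in> ZA p (q - 1)" by blast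
      then have "d x \<in> Bd p q \<inter> Zd' p q" "d' y \<in> Bd' p q \<inter> Zd p q"
        using d_ZA d'_ZA C_of_cycles(3) unfolding Bd_def Bd'_def by blast+
      then show "z \<in> BK p q" using xy(1) unfolding BK_def by blast
    qed
    ultimately show ?thesis unfolding BC_K_maps(3) by auto
  qed
qed

theorem HA_decomposition:
  assumes G: "complement_of (vrestrict (HA p q) (cGd p q)) (coset_map id (BA p q) ` carr (Hd p q)) G"
    and L: "complement_of (HA p q) (cGd p q) L"
    and L': "complement_of (HA p (q - 1)) (cGd' p (q - 1)) L'"
  shows "HA p q \<cong>\<^sub>v vquot (Hd p q) (coset_map d' (Bd p q) ` L') \<oplus>\<^sub>v vrestrict (HA p q) G \<oplus>\<^sub>v vrestrict (HA p q) L"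
proof -
  have carr_Hd: "carr (Hd p q) = coset (Bd p q) ` Zd p q"
    unfolding Hd_def by (intro quot_simps(1) subspaces boundaries)
  have ker: "vker (Hd p q) (HA p q) (coset_map id (BA p q)) = coset_map d' (Bd p q) ` L'"
  proof -
    note g = delbar_A_del_maps(2)[of p q]
    have "coset_map d' (Bd p q) ` carr (HA p (q - 1)) = coset_map d' (Bd p q) ` L'"
    proof (rule image_modulo_kernel[OF cohomology_vspace(2,4) g vspace.subspace_carr[OF cohomology_vspace(2)]])
      show "complement_of (vrestrict (HA p (q - 1)) (carr (HA p (q - 1)))) (cGd' p (q - 1)) L'"
        using L' by (simp add: vrestrict_def)
      show "cGd' p (q - 1) \<subseteq> vker (HA p (q - 1)) (Hd p q) (coset_map d' (Bd p q))"
        by (simp add: cGd'_eq delbar_A_del_maps(3))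
    qed
    moreover have "coset_map d' (Bd p q) ` carr (HA p (q - 1)) = (\<lambda>x. coset (Bd p q) (d' x)) ` ZA p (q - 1)"
      unfolding carr_HA image_image using delbar_A_del_maps(1) by (intro image_cong) auto
    moreover have "coset (Bd p q) ` (Zd p q \<inter> BA p q) = (\<lambda>x. coset (Bd p q) (d' x)) ` ZA p (q - 1)"
    proof (intro equalityI image_subsetI)
      fix x assume x: "x \<in> Zd p q \<inter> BA p q"
      then obtain a b where ab: "x = d a + d' b" "a \<in> C (p - 1) q" "b \<in> C p (q - 1)"
        by (auto simp: BA_def Bd_def Bd'_def)
      have "d x = d (d' b)"
        unfolding ab(1) using lin_d(1)[OF d_pred[OF ab(2)] d'_pred[OF ab(3)]] d_d[OF ab(2)] by simp
      then have "b \<in> ZA p (q - 1)" using x ab(3) by (simp add: Zd_def ZA_def)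
      moreover have "coset (Bd p q) x = coset (Bd p q) (d' b)"
        unfolding coset_eq_iff[OF subspaces(4)] using ab by (simp add: Bd_def)
      ultimately show "coset (Bd p q) x \<in> (\<lambda>x. coset (Bd p q) (d' x)) ` ZA p (q - 1)" by blast
    next
      fix b assume b: "b \<in> ZA p (q - 1)"
      then have "d' b \<in> Bd' p q" using C_of_cycles(3) unfolding Bd'_def by blast
      then have "d' b \<in> Zd p q \<inter> BA p q" using d'_ZA[OF b] boundaries_closed(5) by blast
      then show "coset (Bd p q) (d' b) \<in> coset (Bd p q) ` (Zd p q \<inter> BA p q)" by blast
    qed
    ultimately show ?thesis by (simp add: pi_A_maps(3))
  qed
  have "coset_map id (BA p q) ` carr (Hd p q) \<subseteq> cGd p q"
  proof -
    have "cGd p q = coset (BA p q) ` {x \<in> ZA p q. d x \<in> Bd' (p + 1) q}" using cGd_eq[of "p + 1" q] by simp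
    moreover have "Zd p q \<subseteq> {x \<in> ZA p q. d x \<in> Bd' (p + 1) q}"
      using Zd_subset_ZA subspace_0[OF subspaces(5)] by (auto simp: Zd_def)
    ultimately show ?thesis unfolding carr_Hd image_image using pi_A_maps(1) by auto
  qed
  from decompose_by_filtration[OF cohomology_vspace(2,4) pi_A_maps(2) cGd_subspace this G L]
  show ?thesis unfolding ker .
qed

end

section \<open>The decompositions\<close>

definition form_scale :: "complex \<Rightarrow> ('a, 'n::finite) form \<Rightarrow> ('a, 'n) form" where
  "form_scale a \<omega> = (\<lambda>c z vs. a * \<omega> c z vs)"

lemma form_vector_space: "vector_space (form_scale :: complex \<Rightarrow> ('a, 'n::finite) form \<Rightarrow> ('a, 'n) form)"
  by unfold_locales (auto simp: form_scale_def fun_eq_iff algebra_simps)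

lemma form_complex_space: "complex_space (form_scale :: complex \<Rightarrow> ('a, 'n::finite) form \<Rightarrow> ('a, 'n) form)"
  by (intro complex_space.intro form_vector_space)

lemma forms_double_complex:
  fixes A :: "('a, 'n::finite) chart set"
  assumes A: "complex_atlas X A"
  shows "double_complex form_scale (forms A) (del A) (delbar A)"
    and "double_complex form_scale (\<lambda>p q. forms A q p) (delbar A) (del A)"
proof -
  interpret complex_space "form_scale :: complex \<Rightarrow> ('a, 'n) form \<Rightarrow> ('a, 'n) form"
    by (rule form_complex_space)
  have add: "(\<lambda>c z vs. 1 * \<omega> c z vs + 1 * \<eta> c z vs) = \<omega> + \<eta>"
    and scale: "(\<lambda>c z vs. a * \<omega> c z vs + 0 * \<eta> c z vs) = form_scale a \<omega>" for \<omega> \<eta> :: "('a, 'n) form" and a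
    by (auto simp: form_scale_def fun_eq_iff)
  have sub: "subspace (forms A p q)" for p q
    using forms_linear[OF A, where a=1 and b=1] forms_linear[OF A, where b=0] zero_in_forms
    unfolding add scale by (intro subspaceI) blast+
  have lin: "linear_map_on (forms A p q) (del A)" "linear_map_on (forms A p q) (delbar A)" for p q
    unfolding linear_map_on_def
    using del_delbar_linear[OF A, where a=1 and b=1] del_delbar_linear[OF A, where b=0]
    unfolding add scale by blast+
  note cl = del_delbar_in_forms[OF A] and rel = double_complex_relations[OF A]
  show "double_complex form_scale (forms A) (del A) (delbar A)"
    by unfold_locales (intro sub lin cl rel; assumption)+
  have "delbar A (del A \<omega>) = - del A (delbar A \<omega>)" if "\<omega> \<in> forms A p q" for \<omega> p q
    using rel(3)[OF that] by simp
  note rel' = rel this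
  show "double_complex form_scale (\<lambda>p q. forms A q p) (delbar A) (del A)"
    by unfold_locales (intro sub lin cl rel'; assumption)+
qed

lemma induced_eq: "induced = coset_map"
  by (intro ext) (simp add: induced_def coset_map_def)

theorem lemma5p2:
  fixes X :: "'a topology" and A :: "('a, 'n::finite) chart set"
    and G L Gb Lb :: "int \<Rightarrow> int \<Rightarrow> ('a, 'n) form set set"
  assumes "compact_complex_manifold X A"
    and "\<And>p q. is_G_del A p q (G p q)" and "\<And>p q. is_L_del A p q (L p q)"
    and "\<And>p q. is_G_delbar A p q (Gb p q)" and "\<And>p q. is_L_delbar A p q (Lb p q)"
  shows "\<forall>p q.
    H_BC A p q \<cong>\<^sub>v
        vrestrict (H_BC A p q) (del_A_BC A (p - 1) q ` G (p - 1) q)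
      \<oplus>\<^sub>v vrestrict (H_BC A p q) (del_A_BC A (p - 1) q ` L (p - 1) q)
      \<oplus>\<^sub>v vrestrict (H_BC A p q) (delbar_A_BC A p (q - 1) ` Lb p (q - 1))
      \<oplus>\<^sub>v K A p q \<and>
    H_BC A p q \<cong>\<^sub>v
        vrestrict (H_BC A p q) (delbar_A_BC A p (q - 1) ` Gb p (q - 1))
      \<oplus>\<^sub>v vrestrict (H_BC A p q) (delbar_A_BC A p (q - 1) ` Lb p (q - 1))
      \<oplus>\<^sub>v vrestrict (H_BC A p q) (del_A_BC A (p - 1) q ` L (p - 1) q)
      \<oplus>\<^sub>v K A p q \<and>
    H_A A p q \<cong>\<^sub>v
        vquot (H_del A p q) (delbar_A_del A p (q - 1) ` Lb p (q - 1))
      \<oplus>\<^sub>v vrestrict (H_A A p q) (G p q)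
      \<oplus>\<^sub>v vrestrict (H_A A p q) (L p q) \<and>
    H_A A p q \<cong>\<^sub>v
        vquot (H_delbar A p q) (del_A_delbar A (p - 1) q ` L (p - 1) q)
      \<oplus>\<^sub>v vrestrict (H_A A p q) (Gb p q)
      \<oplus>\<^sub>v vrestrict (H_A A p q) (Lb p q)"
proof -
  have A: "complex_atlas X A"
    using assms(1) by (simp add: compact_complex_manifold_def)
  interpret D: double_complex form_scale "forms A" "del A" "delbar A"
    by (rule forms_double_complex(1)[OF A])
  interpret E: double_complex form_scale "\<lambda>p q. forms A q p" "delbar A" "del A"
    by (rule forms_double_complex(2)[OF A])
  have quot: "vquot (vrestrict (form_space A p q) S) B = D.quot S B" for p q S B
    unfolding D.quot_def D.space_on_def by (simp add: vrestrict_def form_space_def form_scale_def[abs_def])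
  have Z: "ker_del A p q = D.Zd p q" "ker_del A p q = E.Zd' q p"
    "ker_delbar A p q = D.Zd' p q" "ker_delbar A p q = E.Zd q p"
    "ker_deldelbar A p q = D.ZA p q" "ker_deldelbar A p q = E.ZA q p" for p q
    by (auto simp: ker_del_def ker_delbar_def ker_deldelbar_def D.Zd_def D.Zd'_def D.ZA_def
        E.Zd_def E.Zd'_def E.ZA_iff)
  have B: "im_del A p q = D.Bd p q" "im_del A p q = E.Bd' q p"
    "im_delbar A p q = D.Bd' p q" "im_delbar A p q = E.Bd q p"
    "im_deldelbar A p q = D.Bdd' p q" for p q
    by (simp_all add: im_del_def im_delbar_def im_deldelbar_def D.Bd_def D.Bd'_def D.Bdd'_def E.Bd_def E.Bd'_def)
  have Bdd: "im_deldelbar A p q = E.Bdd' q p" for p q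
  proof -
    have "im_deldelbar A p q = uminus ` E.Bdd' q p"
      unfolding im_deldelbar_def E.Bdd'_def image_image by (intro image_cong) (auto simp: D.d_d')
    also have "\<dots> = E.Bdd' q p"
    proof
      have neg: "- x \<in> E.Bdd' q p" if "x \<in> E.Bdd' q p" for x
        using D.subspace_neg[OF E.subspaces(6)] that by blast
      then show "uminus ` E.Bdd' q p \<subseteq> E.Bdd' q p" by blast
      show "E.Bdd' q p \<subseteq> uminus ` E.Bdd' q p"
      proof
        fix x assume "x \<in> E.Bdd' q p"
        then show "x \<in> uminus ` E.Bdd' q p" using imageI[OF neg, of x uminus] by simp
      qed
    qed
    finally show ?thesis .
  qed
  have commute: "{x + y |x y. x \<in> S \<and> y \<in> T} = {x + y |x y. x \<in> T \<and> y \<in> S}" for S T :: "('a, 'n) form set"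
    by (auto simp: add.commute) (metis add.commute)+
  have BA: "sum_of (im_del A p q) (im_delbar A p q) = D.BA p q"
    "sum_of (im_del A p q) (im_delbar A p q) = E.BA q p" for p q
    unfolding sum_of_def D.BA_def E.BA_def B(1,3)[symmetric] B(2,4)[symmetric] by (rule refl commute)+
  have BK: "sum_of (im_del A p q \<inter> ker_delbar A p q) (im_delbar A p q \<inter> ker_del A p q) = D.BK p q"
    "sum_of (im_del A p q \<inter> ker_delbar A p q) (im_delbar A p q \<inter> ker_del A p q) = E.BK q p" for p q
    unfolding sum_of_def D.BK_def E.BK_def B(1,3)[symmetric] B(2,4)[symmetric]
      Z(1,3)[symmetric] Z(2,4)[symmetric] by (rule refl commute)+
  have H: "H_BC A p q = D.HBC p q" "H_A A p q = D.HA p q" "K A p q = D.HK p q"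
    "H_del A p q = D.Hd p q" "H_delbar A p q = D.Hd' p q" for p q
    unfolding H_BC_def H_A_def K_def H_del_def H_delbar_def quot BA(1) BK(1)
    unfolding B(1,3,5) Z(1,3,5) D.HBC_def D.HA_def D.HK_def D.Hd_def D.Hd'_def by (rule refl)+
  have H': "H_BC A p q = E.HBC q p" "H_A A p q = E.HA q p" "K A p q = E.HK q p"
    "H_del A p q = E.Hd' q p" "H_delbar A p q = E.Hd q p" for p q
    unfolding H_BC_def H_A_def K_def H_del_def H_delbar_def quot BA(2) BK(2)
    unfolding B(2,4) Bdd Z(2,4,6) E.HBC_def E.HA_def E.HK_def E.Hd_def E.Hd'_def
    by (rule refl Int_commute arg_cong2[where f=D.quot])+
  have cG: "cG_del A p q = D.cGd p q" "cG_del A p q = E.cGd' q p"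
    "cG_delbar A p q = D.cGd' p q" "cG_delbar A p q = E.cGd q p" for p q
    by (simp_all add: cG_del_def cG_delbar_def D.cGd_def D.cGd'_def E.cGd_def E.cGd'_def vker_def
        del_A_delbar_def delbar_A_del_def induced_eq H[symmetric] H'[symmetric] B[symmetric])
  have G: "complement_of (vrestrict (D.HA p q) (D.cGd p q)) (coset_map id (D.BA p q) ` carr (D.Hd p q)) (G p q)"
    "complement_of (vrestrict (E.HA q p) (E.cGd q p)) (coset_map id (E.BA q p) ` carr (E.Hd q p)) (Gb p q)" for p q
    using assms(2)[of p q] assms(4)[of p q]
    by (simp_all add: is_G_del_def is_G_delbar_def pi_A_def induced_eq
        H[symmetric] H'[symmetric] cG[symmetric] BA[symmetric])
  have L: "complement_of (D.HA p q) (D.cGd p q) (L p q)" "complement_of (E.HA q p) (E.cGd' q p) (L p q)"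
    "complement_of (D.HA p q) (D.cGd' p q) (Lb p q)" "complement_of (E.HA q p) (E.cGd q p) (Lb p q)" for p q
    using assms(3)[of p q] assms(5)[of p q]
    by (simp_all add: is_L_del_def is_L_delbar_def H[symmetric] H'[symmetric] cG[symmetric])
  show ?thesis
  proof (intro allI conjI)
    fix p q
    show "H_BC A p q \<cong>\<^sub>v vrestrict (H_BC A p q) (del_A_BC A (p - 1) q ` G (p - 1) q)
      \<oplus>\<^sub>v vrestrict (H_BC A p q) (del_A_BC A (p - 1) q ` L (p - 1) q)
      \<oplus>\<^sub>v vrestrict (H_BC A p q) (delbar_A_BC A p (q - 1) ` Lb p (q - 1)) \<oplus>\<^sub>v K A p q"
      using D.HBC_decomposition[OF G(1) L(1) L(3)]
      by (simp add: del_A_BC_def delbar_A_BC_def induced_eq H[symmetric] B[symmetric])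
    show "H_BC A p q \<cong>\<^sub>v vrestrict (H_BC A p q) (delbar_A_BC A p (q - 1) ` Gb p (q - 1))
      \<oplus>\<^sub>v vrestrict (H_BC A p q) (delbar_A_BC A p (q - 1) ` Lb p (q - 1))
      \<oplus>\<^sub>v vrestrict (H_BC A p q) (del_A_BC A (p - 1) q ` L (p - 1) q) \<oplus>\<^sub>v K A p q"
      using E.HBC_decomposition[OF G(2) L(4) L(2)]
      by (simp add: del_A_BC_def delbar_A_BC_def induced_eq H'[symmetric] Bdd[symmetric])
    show "H_A A p q \<cong>\<^sub>v vquot (H_del A p q) (delbar_A_del A p (q - 1) ` Lb p (q - 1))
      \<oplus>\<^sub>v vrestrict (H_A A p q) (G p q) \<oplus>\<^sub>v vrestrict (H_A A p q) (L p q)"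
      using D.HA_decomposition[OF G(1) L(1) L(3)]
      by (simp add: delbar_A_del_def induced_eq H[symmetric] B[symmetric])
    show "H_A A p q \<cong>\<^sub>v vquot (H_delbar A p q) (del_A_delbar A (p - 1) q ` L (p - 1) q)
      \<oplus>\<^sub>v vrestrict (H_A A p q) (Gb p q) \<oplus>\<^sub>v vrestrict (H_A A p q) (Lb p q)"
      using E.HA_decomposition[OF G(2) L(4) L(2)]
      by (simp add: del_A_delbar_def induced_eq H'[symmetric] B[symmetric])
  qed
qed

end
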